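(* Assume that $\mathbb{E}(\nu_v^2+\omega_e^2)<\infty$. Then there exist constants $f\in\mathbb{R}$ and $\sigma_F\in(0,\infty)$, depending on the distributions of the edge weights $\omega$ and the vertex weights $\nu$, such that, as $n\to\infty$, $$n^{-1}\log Z_n\to f \text{ in probability}\qquad\text{and}\qquad n^{-1}\operatorname{Var}(\log Z_n)\to\sigma_F^2 .$$
   Context: Let $H=(V_H,E_H)$ be a fixed finite graph with $|V_H|=h$, and let $G_n$ be the line graph (path) on the $n$ vertices $1,\dots,n$ with $i\sim i+1$. The cylinder graph $\mathcal{G}_n=G_n\times H$ is the Cartesian product: its vertex set is $V=\{1,\dots,n\}\times V_H$, and $(i,j)\sim(i',j')$ iff either $i\sim i'$ in $G_n$ and $j=j'$, or $i=i'$ and $j\sim j'$ in $H$. Let $E$ be its edge set. The vertex weights $\{\nu_v\}_{v\in V}$ are i.i.d. real-valued random variables; the edge weights $\{\omega_e\}_{e\in E}$ are i.i.d. real-valued random variables, independent of the vertex weights, not necessarily with the same distribution; the two distributions do not depend on $n$. A matching $\mathfrak{m}\subseteq E$ is a (possibly empty) set of pairwise vertex-disjoint edges; $\mathcal{M}$ is the set of all matchings of $\mathcal{G}_n$; $v\notin\mathfrak{m}$ means that $v$ is not covered by any edge of $\mathfrak{m}$. The Hamiltonian is $\mathcal{H}(\mathfrak{m})=\sum_{v\notin\mathfrak{m}}\nu_v+\sum_{e\in\mathfrak{m}}\omega_e$, and the partition function is $Z_n=\sum_{\mathfrak{m}\in\mathcal{M}}\exp(\mathcal{H}(\mathfrak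{m}))$.
   Formalization: The formal theorem also assumes that the vertex-weight and edge-weight distributions are not both point masses and that H has at least one vertex; otherwise Var(log Z_n)=0 for all n, and σ_F>0 is impossible. *)

theory Defs
  imports "HOL-Probability.Probability"
begin

definition finite_simple_graph :: "'a set \<Rightarrow> 'a set set \<Rightarrow> bool" where
  "finite_simple_graph V E \<longleftrightarrow> finite V \<and> (\<forall>e\<in>E. e \<subseteq> V \<and> card e = 2)"

definition line_edges :: "nat \<Rightarrow> nat set set" where
  "line_edges n = {{i, i + 1} | i. 1 \<le> i \<and> i < n}"

definition cartesian_product_edges ::
  "'a set \<Rightarrow> 'a set set \<Rightarrow> 'b set \<Rightarrow> 'b set set \<Rightarrow> ('a \<times> 'b) set set" where
  "cartesian_product_edges VG EG VH EH =
     {{(i, j), (i', j')} | i j i' j'.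
        i \<in> VG \<and> i' \<in> VG \<and> j \<in> VH \<and> j' \<in> VH \<and>
        ({i, i'} \<in> EG \<and> j = j' \<or> i = i' \<and> {j, j'} \<in> EH)}"

definition cylinder_verts :: "'v set \<Rightarrow> nat \<Rightarrow> (nat \<times> 'v) set" where
  "cylinder_verts VH n = {1..n} \<times> VH"

definition cylinder_edges :: "'v set \<Rightarrow> 'v set set \<Rightarrow> nat \<Rightarrow> (nat \<times> 'v) set set" where
  "cylinder_edges VH EH n = cartesian_product_edges {1..n} (line_edges n) VH EH"

definition matchings :: "'a set set \<Rightarrow> 'a set set set" where
  "matchings E = {m. m \<subseteq> E \<and> disjoint m}"

definition hamiltonian :: "'a set \<Rightarrow> ('a \<Rightarrow> real) \<Rightarrow> ('a set \<Rightarrow> real) \<Rightarrow> 'a set set \<Rightarrow> real" where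
  "hamiltonian V \<nu> \<omega> m = (\<Sum>v\<in>V - \<Union>m. \<nu> v) + (\<Sum>e\<in>m. \<omega> e)"

definition partition_function ::
  "'a set \<Rightarrow> 'a set set \<Rightarrow> ('a \<Rightarrow> real) \<Rightarrow> ('a set \<Rightarrow> real) \<Rightarrow> real" where
  "partition_function V E \<nu> \<omega> = (\<Sum>m\<in>matchings E. exp (hamiltonian V \<nu> \<omega> m))"

text \<open>
  On the probability space \<open>M\<close>, the vertex weights \<open>\<nu>\<close> have law \<open>N\<close>, the edge weights \<open>\<omega>\<close> have
  law \<open>W\<close>, and all weights together are mutually independent (the joint family is indexed
  by the disjoint sum of \<open>V\<close> and \<open>E\<close>).
\<close>

definition iid_weights ::
  "'m measure \<Rightarrow> real measure \<Rightarrow> real measure \<Rightarrow> 'a set \<Rightarrow> 'a set set \<Rightarrow>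
   ('a \<Rightarrow> 'm \<Rightarrow> real) \<Rightarrow> ('a set \<Rightarrow> 'm \<Rightarrow> real) \<Rightarrow> bool" where
  "iid_weights M N W V E \<nu> \<omega> \<longleftrightarrow>
     prob_space M \<and>
     prob_space.indep_vars M (\<lambda>_. borel) (case_sum \<nu> \<omega>) (V <+> E) \<and>
     (\<forall>v\<in>V. distr M borel (\<nu> v) = N) \<and>
     (\<forall>e\<in>E. distr M borel (\<omega> e) = W)"

definition log_partition ::
  "'a set \<Rightarrow> 'a set set \<Rightarrow> ('a \<Rightarrow> 'm \<Rightarrow> real) \<Rightarrow> ('a set \<Rightarrow> 'm \<Rightarrow> real) \<Rightarrow> 'm \<Rightarrow> real" where
  "log_partition V E \<nu> \<omega> x = ln (partition_function V E (\<lambda>v. \<nu> v x) (\<lambda>e. \<omega> e x))"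

text \<open>Convergence in probability to a constant; the \<open>n\<close>-th variable may live on its own space.\<close>

definition tendsto_in_prob ::
  "(nat \<Rightarrow> 'm measure) \<Rightarrow> (nat \<Rightarrow> 'm \<Rightarrow> real) \<Rightarrow> real \<Rightarrow> bool" where
  "tendsto_in_prob M X c \<longleftrightarrow>
     (\<forall>\<epsilon>>0. (\<lambda>n. measure (M n) {x \<in> space (M n). \<bar>X n x - c\<bar> > \<epsilon>}) \<longlonglongrightarrow> 0)"

definition degenerate_law :: "real measure \<Rightarrow> bool" where
  "degenerate_law N \<longleftrightarrow> (\<exists>c. AE x in N. x = c)"

end

theory Submission
  imports Defs
begin

text \<open>
  Cutting the cylinder of length \<open>m + n\<close> along the \<open>card VH\<close> edges between layers \<open>m\<close> and \<open>m + 1\<close>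
  gives two independent cylinders. Deleting an edge \<open>e = {u, v}\<close> changes \<open>log Z\<close> by at most
  \<open>ln (1 + exp (\<omega> e - \<nu> u - \<nu> v))\<close>, hence
  \<open>log Z(m + n) = log Z(m) + log Z'(n) + R\<close> with independent first summands and \<open>R\<close> bounded
  in \<open>L\<^sup>2\<close> uniformly in \<open>m\<close> and \<open>n\<close>. So the mean is additive up to a bounded error and the standard
  deviation is additive in squares up to a bounded error; the latter forces the variance to be
  \<open>O(n)\<close>, and then additive up to an error \<open>O(sqrt (m + n))\<close>. This suffices for both limits
  to exist, and Chebyshev's inequality turns the convergence of the means into convergence in
  probability.

  For positivity of the limiting variance, \<open>Z = a * exp Y + b\<close> as a function of any single weight \<open>Y\<close>,
  where \<open>b / a\<close> is controlled by boundedly many weights near it. Therefore the covariance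
  of \<open>log Z\<close> with a nondegenerate \<open>Y\<close> is bounded below uniformly, and Cauchy--Schwarz applied to \<open>log Z\<close>
  and the sum of one such weight per layer gives a variance of order \<open>n\<close>.
\<close>

section \<open>Almost additive sequences\<close>

text \<open>The error \<open>R\<close> depends on weights at the cut, so it is correlated with both
  pieces and variances cannot simply be added. The standard deviation is a seminorm and absorbs
  \<open>R\<close> whatever the correlation. Passing from it to the variance costs a factor of its
  own size, which is why a growth bound has to come before the variance can be treated as almost
  additive. An error of order \<open>sqrt (m + n)\<close> is harmless only if blocks are joined by
  repeated halving: joining \<open>m\<close> blocks of length \<open>n\<close> one at a time would
  accumulate an error of order \<open>m * sqrt (m * n)\<close>, too large against
  \<open>m * n\<close>.

  In the lower bound, \<open>b / a\<close> is not bounded; only an upper bound for its logarithm has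
  a mean bounded uniformly in \<open>n\<close>. Markov's inequality then gives control with
  probability at least 1/2, which is enough because the integrand is nonnegative. This control must
  not involve \<open>Y\<close>, since its independence of \<open>Y\<close> is used.\<close>

lemma sqrt_halves:
  fixes n :: nat
  assumes "2 \<le> n"
  shows "5 / 4 * sqrt n \<le> sqrt (n div 2) + sqrt (n - n div 2)"
proof -
  define p q where "p = n div 2" and "q = n - n div 2"
  have pq: "p + q = n" "n \<le> 3 * p" "n \<le> 3 * q"
    using assms unfolding p_def q_def by auto
  \<comment> \<open>Each half is at least \<open>n / 3\<close>, so
    \<open>(sqrt p + sqrt q)\<^sup>2\<close> is at least \<open>5 * n / 3\<close>, more than the
    \<open>25 * n / 16\<close> required. The gain of \<open>5 / 4\<close> over 1 is what pays for
    the errors in the two inductions by halving below.\<close>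
  have "real n * real n \<le> (3 * real p) * (3 * real q)"
    using pq by (intro mult_mono) linarith+
  then have "(real n / 3)\<^sup>2 \<le> real p * real q"
    by (simp add: power2_eq_square)
  then have *: "real n / 3 \<le> sqrt (real p * real q)"
    by (rule real_le_rsqrt)
  have "(5 / 4 * sqrt n)\<^sup>2 = 25 / 16 * real n"
    by (simp add: power_mult_distrib power2_eq_square)
  also have "\<dots> \<le> real n + 2 * sqrt (real p * real q)"
    using * by simp
  also have "\<dots> = (sqrt p + sqrt q)\<^sup>2"
    using pq(1) by (simp add: power2_sum real_sqrt_mult flip: of_nat_add)
  finally show ?thesis
    unfolding p_def q_def by (rule power2_le_imp_le) simp
qed

text \<open>Halving \<open>m\<close> gives an error linear in \<open>m\<close>. The term
  \<open>- 4 * sqrt m\<close> strengthens the induction hypothesis: the two halves together save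
  \<open>4 * (5 / 4) * sqrt m\<close>, of which one \<open>sqrt m\<close> pays for joining them and
  four are passed on. At \<open>m = 1\<close> the bound is exactly 0, as it must be.\<close>

lemma almost_additive_multiple:
  fixes a :: "nat \<Rightarrow> real"
  assumes add: "\<And>m n. \<lbrakk>1 \<le> m; 1 \<le> n\<rbrakk> \<Longrightarrow> \<bar>a (m + n) - a m - a n\<bar> \<le> C * sqrt (real m + real n)"
    and "1 \<le> m" "1 \<le> n"
  shows "\<bar>a (m * n) - m * a n\<bar> \<le> C * sqrt n * (4 * real m - 4 * sqrt m)"
  using \<open>1 \<le> m\<close>
proof (induction m rule: less_induct)
  case (less m)
  have "0 \<le> C * sqrt 2"
    using order_trans[OF abs_ge_zero add[of 1 1]] by simp
  then have C: "0 \<le> C"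
    by (simp add: zero_le_mult_iff)
  show ?case
  proof (cases "m = 1")
    case True
    then show ?thesis by simp
  next
    case False
    define p q where "p = m div 2" and "q = m - m div 2"
    have pq: "p < m" "q < m" "1 \<le> p" "1 \<le> q" "m = p + q"
      using False less.prems unfolding p_def q_def by auto
    have halves: "5 / 4 * sqrt m \<le> sqrt p + sqrt q"
      using sqrt_halves[of m] False less.prems unfolding p_def q_def by simp
    have "\<bar>a (p * n + q * n) - a (p * n) - a (q * n)\<bar> \<le> C * sqrt (real (p * n) + real (q * n))"
      using add[of "p * n" "q * n"] pq \<open>1 \<le> n\<close> by simp
    also have "real (p * n) + real (q * n) = real n * real m"
      using pq(5) by (simp add: algebra_simps)
    also have "C * sqrt (real n * real m) = C * sqrt n * sqrt m"
      by (simp add: real_sqrt_mult)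
    finally have "\<bar>a (m * n) - a (p * n) - a (q * n)\<bar> \<le> C * sqrt n * sqrt m"
      using pq(5) by (simp add: algebra_simps)
    moreover have "real m * a n = real p * a n + real q * a n"
      using pq(5) by (simp add: algebra_simps)
    ultimately have "\<bar>a (m * n) - m * a n\<bar> \<le> C * sqrt n * (4 * real p - 4 * sqrt p)
        + C * sqrt n * (4 * real q - 4 * sqrt q) + C * sqrt n * sqrt m"
      using less.IH[OF pq(1,3)] less.IH[OF pq(2,4)] by linarith
    also have "\<dots> = C * sqrt n * (4 * real m - 4 * (sqrt p + sqrt q) + sqrt m)"
      using pq(5) by (simp add: algebra_simps)
    also have "\<dots> \<le> C * sqrt n * (4 * real m - 4 * sqrt m)"
      using halves C by (intro mult_left_mono) auto
    finally show ?thesis .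
  qed
qed

text \<open>Comparing both \<open>a m / m\<close> and \<open>a n / n\<close> with \<open>a (m * n) / (m * n)\<close> gives a Cauchy sequence.\<close>

lemma almost_additive_convergent:
  fixes a :: "nat \<Rightarrow> real"
  assumes add: "\<And>m n. \<lbrakk>1 \<le> m; 1 \<le> n\<rbrakk> \<Longrightarrow> \<bar>a (m + n) - a m - a n\<bar> \<le> C * sqrt (real m + real n)"
  shows "convergent (\<lambda>n. a n / n)"
proof -
  have "0 \<le> C * sqrt 2"
    using order_trans[OF abs_ge_zero add[of 1 1]] by simp
  then have C: "0 \<le> C"
    by (simp add: zero_le_mult_iff)
  have *: "\<bar>a (m * n) / (m * n) - a n / n\<bar> \<le> 4 * C / sqrt n" if "1 \<le> m" "1 \<le> n" for m n
  proof -
    have "C * sqrt n * (4 * real m - 4 * sqrt m) \<le> C * sqrt n * (4 * real m)"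
      using C by (intro mult_left_mono) auto
    then have "\<bar>a (m * n) - m * a n\<bar> \<le> C * sqrt n * (4 * real m)"
      using almost_additive_multiple[OF add that] by linarith
    then have "\<bar>a (m * n) - m * a n\<bar> / (m * n) \<le> C * sqrt n * (4 * real m) / (m * n)"
      by (intro divide_right_mono) auto
    moreover have "\<bar>a (m * n) - m * a n\<bar> / (m * n) = \<bar>a (m * n) / (m * n) - a n / n\<bar>"
    proof -
      have "a (m * n) / (m * n) - a n / n = (a (m * n) - m * a n) / (m * n)"
        using that by (simp add: field_simps)
      then show ?thesis by simp
    qed
    moreover have "C * sqrt n * (4 * real m) / (m * n) = 4 * C / sqrt n"
      using that by (simp add: field_simps)
    ultimately show ?thesis by simp
  qed
  have "Cauchy (\<lambda>n. a n / n)"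
  proof (rule metric_CauchyI)
    fix e :: real assume "e > 0"
    have "(\<lambda>n::nat. 4 * C / sqrt n) \<longlonglongrightarrow> 0"
      by (intro real_tendsto_divide_at_top[OF tendsto_const]
          filterlim_compose[OF sqrt_at_top filterlim_real_sequentially])
    then obtain K where K: "\<And>n. n \<ge> K \<Longrightarrow> 4 * C / sqrt (real n) < e / 2"
      using \<open>e > 0\<close> order_tendstoD(2)[of _ 0 sequentially "e / 2"]
      by (force simp: eventually_sequentially)
    show "\<exists>K. \<forall>m\<ge>K. \<forall>n\<ge>K. dist (a m / m) (a n / n) < e"
    proof (intro exI[of _ "max 1 K"] allI impI)
      fix m n assume mn: "m \<ge> max 1 K" "n \<ge> max 1 K"
      have "\<bar>a (m * n) / (m * n) - a n / n\<bar> < e / 2"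
        using *[of m n] K[of n] mn by simp
      moreover have "\<bar>a (m * n) / (m * n) - a m / m\<bar> < e / 2"
        using *[of n m] K[of m] mn by (simp add: mult.commute[of n m] mult.commute[of "real n" "real m"])
      ultimately show "dist (a m / m) (a n / n) < e"
        unfolding dist_real_def by linarith
    qed
  qed
  then show ?thesis
    by (rule Cauchy_convergent)
qed

text \<open>The triangle inequality alone would allow linear growth of \<open>s\<close>; the
  Pythagorean form of the recursion is what yields the square root. The induction proves the
  stronger bound \<open>A * sqrt n - 8 * C\<close>. Squaring it for the two halves produces a cross
  term of at least \<open>20 * C * A * sqrt n\<close>, while the square of
  \<open>A * sqrt n - 9 * C\<close> uses only 18 of these 20; the rest absorbs the constants, and
  adding the error \<open>C\<close> restores \<open>8 * C\<close>.\<close>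

lemma sqrt_growth_bound:
  fixes s :: "nat \<Rightarrow> real"
  assumes nonneg: "\<And>n. 0 \<le> s n" and C: "0 < C"
    and subadd: "\<And>m n. \<lbrakk>1 \<le> m; 1 \<le> n\<rbrakk> \<Longrightarrow> s (m + n) \<le> sqrt ((s m)\<^sup>2 + (s n)\<^sup>2) + C"
  obtains A where "0 \<le> A" "\<And>n. 1 \<le> n \<Longrightarrow> s n \<le> A * sqrt n"
proof -
  \<comment> \<open>The summand \<open>s 1\<close> settles the base case. The multiple of
    \<open>C\<close> keeps \<open>A * sqrt n - 9 * C\<close> nonnegative and makes the surplus
    \<open>2 * C * A * sqrt n\<close> at least 144 times the square of \<open>C\<close>, more than
    the excess 128 - 81.\<close>
  define A where "A = s 1 + 72 * C"
  have A: "72 * C \<le> A"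
    using nonneg[of 1] by (simp add: A_def)
  have bound: "s n \<le> A * sqrt n - 8 * C" if "1 \<le> n" for n
    using that
  proof (induction n rule: less_induct)
    case (less n)
    show ?case
    proof (cases "n = 1")
      case True
      then show ?thesis using C by (simp add: A_def)
    next
      case False
      define p q where "p = n div 2" and "q = n - n div 2"
      have pq: "p < n" "q < n" "1 \<le> p" "1 \<le> q" "n = p + q"
        using False less.prems unfolding p_def q_def by auto
      have halves: "5 / 4 * sqrt n \<le> sqrt p + sqrt q"
        using sqrt_halves[of n] False less.prems unfolding p_def q_def by simp
      have sn: "1 \<le> sqrt n" using less.prems by simp
      have "72 * C * 1 \<le> A * sqrt n"
        using A C sn by (intro mult_mono) auto
      then have big: "0 \<le> A * sqrt n - 9 * C" using C by simp
      have "(s p)\<^sup>2 + (s q)\<^sup>2 \<le> (A * sqrt p - 8 * C)\<^sup>2 + (A * sqrt q - 8 * C)\<^sup>2"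
        using less.IH[OF pq(1,3)] less.IH[OF pq(2,4)] nonneg
        by (intro add_mono power_mono) auto
      also have "\<dots> = A\<^sup>2 * n - 16 * C * A * (sqrt p + sqrt q) + 128 * C\<^sup>2"
        using pq(5) by (simp add: power2_eq_square algebra_simps)
      also have "\<dots> \<le> A\<^sup>2 * n - 16 * C * A * (5 / 4 * sqrt n) + 128 * C\<^sup>2"
        using A C halves by (intro add_mono diff_mono mult_left_mono) auto
      also have "\<dots> = A\<^sup>2 * n - 18 * C * (A * sqrt n) - 2 * C * (A * sqrt n) + 128 * C\<^sup>2"
        by (simp add: algebra_simps)
      also have "\<dots> \<le> A\<^sup>2 * n - 18 * C * (A * sqrt n) + 81 * C\<^sup>2"
      proof -
        have "2 * C * (72 * C * 1) \<le> 2 * C * (A * sqrt n)"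
          using \<open>72 * C * 1 \<le> A * sqrt n\<close> C by (intro mult_left_mono) auto
        then have "144 * C\<^sup>2 \<le> 2 * C * (A * sqrt n)"
          by (simp add: power2_eq_square)
        then show ?thesis
          using zero_le_power2[of C] by linarith
      qed
      also have "\<dots> = (A * sqrt n - 9 * C)\<^sup>2"
        by (simp add: power2_eq_square algebra_simps)
      finally have "sqrt ((s p)\<^sup>2 + (s q)\<^sup>2) \<le> A * sqrt n - 9 * C"
        using big by (intro real_le_lsqrt) auto
      then show ?thesis
        using subadd[OF pq(3,4)] pq(5) by simp
    qed
  qed
  show ?thesis
  proof (rule that)
    show "0 \<le> A" using A C by simp
    show "s n \<le> A * sqrt n" if "1 \<le> n" for n
      using bound[OF that] C by simp
  qed
qed

section \<open>Partition functions of finite graphs\<close>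

lemma finite_simple_graph_finite_edges:
  "finite_simple_graph V E \<Longrightarrow> finite E"
  unfolding finite_simple_graph_def by (meson Pow_iff finite_Pow_iff finite_subset subsetI)

lemma finite_simple_graph_subset:
  "finite_simple_graph V E \<Longrightarrow> E' \<subseteq> E \<Longrightarrow> finite_simple_graph V E'"
  unfolding finite_simple_graph_def by auto

lemma finite_simple_graph_edgeD:
  assumes "finite_simple_graph V E" "e \<in> E"
  shows "finite e" "card e = 2" "e \<subseteq> V" "e \<noteq> {}"
  using assms unfolding finite_simple_graph_def by (auto intro: finite_subset)

lemma finite_matchings [simp]: "finite E \<Longrightarrow> finite (matchings E)"
  unfolding matchings_def by (rule finite_subset[of _ "Pow E"]) auto

lemma matchings_mono: "E' \<subseteq> E \<Longrightarrow> matchings E' \<subseteq> matchings E"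
  unfolding matchings_def by auto

lemma empty_in_matchings [simp]: "{} \<in> matchings E"
  unfolding matchings_def by (auto simp: disjoint_def)

lemma partition_function_mono:
  assumes "finite E" "E' \<subseteq> E"
  shows "partition_function V E' \<nu> \<omega> \<le> partition_function V E \<nu> \<omega>"
  unfolding partition_function_def using assms
  by (intro sum_mono2 matchings_mono) auto

lemma partition_function_no_edges:
  "partition_function V {} \<nu> \<omega> = exp (\<Sum>v\<in>V. \<nu> v)"
proof -
  have "matchings ({} :: 'a set set) = {{}}"
    unfolding matchings_def by (auto simp: disjoint_def)
  then show ?thesis
    by (simp add: partition_function_def hamiltonian_def)
qed

lemma partition_function_lower:
  assumes "finite E"
  shows "exp (\<Sum>v\<in>V. \<nu> v) \<le> partition_function V E \<nu> \<omega>"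
  using partition_function_mono[OF assms, of "{}" V \<nu> \<omega>]
  by (simp add: partition_function_no_edges)

lemma partition_function_pos:
  assumes "finite E"
  shows "0 < partition_function V E \<nu> \<omega>"
  using partition_function_lower[OF assms] exp_gt_zero by (rule less_le_trans[rotated])

lemma partition_function_cong:
  assumes "\<And>v. v \<in> V \<Longrightarrow> \<nu> v = \<nu>' v" "\<And>e. e \<in> E \<Longrightarrow> \<omega> e = \<omega>' e"
  shows "partition_function V E \<nu> \<omega> = partition_function V E \<nu>' \<omega>'"
  unfolding partition_function_def
proof (intro sum.cong refl arg_cong[where f = exp])
  fix m assume "m \<in> matchings E"
  then have "m \<subseteq> E" by (simp add: matchings_def)
  then show "hamiltonian V \<nu> \<omega> m = hamiltonian V \<nu>' \<omega>' m"
    unfolding hamiltonian_def using assms by (intro arg_cong2[where f = "(+)"] sum.cong) auto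
qed

lemma disjoint_insert_iff:
  "x \<notin> A \<Longrightarrow> disjoint (insert x A) \<longleftrightarrow> disjoint A \<and> (\<forall>y\<in>A. y \<inter> x = {})"
  unfolding disjoint_def by (metis Int_commute insertCI insertE)

text \<open>Matchings are sorted by whether they use \<open>e\<close>; those that do are
  \<open>e\<close> together with an arbitrary matching of the edges avoiding both ends.\<close>

lemma partition_function_edge:
  assumes G: "finite_simple_graph V E" and e: "e \<in> E"
  shows "partition_function V E \<nu> \<omega> = partition_function V (E - {e}) \<nu> \<omega>
    + exp (\<omega> e) * partition_function (V - e) {e'\<in>E. e' \<inter> e = {}} \<nu> \<omega>"
proof -
  let ?D = "{e'\<in>E. e' \<inter> e = {}}"
  have fin: "finite E" and "e \<noteq> {}"
    using finite_simple_graph_finite_edges[OF G] finite_simple_graph_edgeD[OF G e] by auto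
  have notin: "e \<notin> m" if "m \<in> matchings ?D" for m
    using that \<open>e \<noteq> {}\<close> by (auto simp: matchings_def)
  have split: "matchings E = matchings (E - {e}) \<union> insert e ` matchings ?D"
  proof (intro equalityI subsetI)
    fix m assume m: "m \<in> matchings E"
    show "m \<in> matchings (E - {e}) \<union> insert e ` matchings ?D"
    proof (cases "e \<in> m")
      case True
      then have m': "m = insert e (m - {e})" by auto
      then have "disjoint (insert e (m - {e}))"
        using m by (simp add: matchings_def)
      then have "m - {e} \<in> matchings ?D"
        using m disjoint_insert_iff[of e "m - {e}"] unfolding matchings_def by auto
      with m' show ?thesis by blast
    next
      case False
      then show ?thesis using m by (auto simp: matchings_def)
    qed
  next
    fix m assume "m \<in> matchings (E - {e}) \<union> insert e ` matchings ?D"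
    then show "m \<in> matchings E"
    proof
      assume "m \<in> insert e ` matchings ?D"
      then obtain k where k: "k \<in> matchings ?D" "m = insert e k" by auto
      then show ?thesis
        using notin[of k] e disjoint_insert_iff[of e k] unfolding matchings_def by auto
    qed (auto simp: matchings_def)
  qed
  have inj: "inj_on (insert e) (matchings ?D)"
    using notin by (intro inj_onI) (metis insert_ident)
  have ham: "hamiltonian V \<nu> \<omega> (insert e m) = \<omega> e + hamiltonian (V - e) \<nu> \<omega> m"
    if m: "m \<in> matchings ?D" for m
  proof -
    have "finite m"
      using m fin by (auto simp: matchings_def intro: finite_subset)
    moreover have "V - \<Union>(insert e m) = V - e - \<Union>m" by auto
    ultimately show ?thesis
      using notin[OF m] by (simp add: hamiltonian_def)
  qed
  have "partition_function V E \<nu> \<omega> = partition_function V (E - {e}) \<nu> \<omega>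
      + (\<Sum>m\<in>insert e ` matchings ?D. exp (hamiltonian V \<nu> \<omega> m))"
    unfolding partition_function_def split using fin
    by (intro sum.union_disjoint) (auto simp: matchings_def)
  also have "(\<Sum>m\<in>insert e ` matchings ?D. exp (hamiltonian V \<nu> \<omega> m))
      = (\<Sum>m\<in>matchings ?D. exp (\<omega> e) * exp (hamiltonian (V - e) \<nu> \<omega> m))"
    using inj by (simp add: sum.reindex ham exp_add cong: sum.cong)
  finally show ?thesis
    by (simp add: partition_function_def sum_distrib_left)
qed

lemma partition_function_isolated:
  assumes "finite V" "U \<subseteq> V" and "\<And>e. e \<in> E \<Longrightarrow> e \<inter> U = {}"
  shows "partition_function V E \<nu> \<omega> = exp (\<Sum>v\<in>U. \<nu> v) * partition_function (V - U) E \<nu> \<omega>"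
proof -
  have "hamiltonian V \<nu> \<omega> m = (\<Sum>v\<in>U. \<nu> v) + hamiltonian (V - U) \<nu> \<omega> m" if "m \<in> matchings E" for m
  proof -
    have "\<Union>m \<inter> U = {}"
      using that assms(3) by (force simp: matchings_def)
    then have "V - \<Union>m = U \<union> (V - U - \<Union>m)" and "U \<inter> (V - U - \<Union>m) = {}"
      using assms(2) by auto
    moreover have "finite U" using assms(1,2) by (rule finite_subset[rotated])
    ultimately have "(\<Sum>v\<in>V - \<Union>m. \<nu> v) = (\<Sum>v\<in>U. \<nu> v) + (\<Sum>v\<in>V - U - \<Union>m. \<nu> v)"
      using assms(1) by (metis finite_Diff sum.union_disjoint)
    then show ?thesis by (simp add: hamiltonian_def)
  qed
  then show ?thesis
    by (simp add: partition_function_def sum_distrib_left exp_add cong: sum.cong)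
qed

section \<open>Deleting edges, splitting components, varying a single weight\<close>

definition edge_cost :: "('a \<Rightarrow> real) \<Rightarrow> ('a set \<Rightarrow> real) \<Rightarrow> 'a set \<Rightarrow> real" where
  "edge_cost \<nu> \<omega> e = ln (1 + exp (\<omega> e - (\<Sum>v\<in>e. \<nu> v)))"

lemma edge_cost_nonneg [simp]: "0 \<le> edge_cost \<nu> \<omega> e"
  by (simp add: edge_cost_def)

text \<open>Since \<open>1 + exp x <= 2 * exp \<bar>x\<bar>\<close> and \<open>2 <= exp 1\<close>,
  the cost grows only linearly in the weights. This is what makes it square integrable under second
  moments alone.\<close>

lemma edge_cost_le: "edge_cost \<nu> \<omega> e \<le> 1 + \<bar>\<omega> e\<bar> + (\<Sum>v\<in>e. \<bar>\<nu> v\<bar>)"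
proof -
  let ?x = "\<omega> e - (\<Sum>v\<in>e. \<nu> v)"
  have "1 \<le> exp \<bar>?x\<bar>" "exp ?x \<le> exp \<bar>?x\<bar>"
    by auto
  moreover have "2 \<le> exp (1::real)"
    using exp_ge_add_one_self[of 1] by simp
  ultimately have "1 + exp ?x \<le> exp 1 * exp \<bar>?x\<bar>"
    using mult_right_mono[of 2 "exp 1" "exp \<bar>?x\<bar>"] by linarith
  then have "edge_cost \<nu> \<omega> e \<le> ln (exp (1 + \<bar>?x\<bar>))"
    unfolding edge_cost_def by (intro ln_mono) (auto simp: exp_add add_pos_pos)
  also have "\<dots> \<le> 1 + (\<bar>\<omega> e\<bar> + \<bar>\<Sum>v\<in>e. \<nu> v\<bar>)"
    using abs_triangle_ineq4[of "\<omega> e" "\<Sum>v\<in>e. \<nu> v"] by simp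
  also have "\<bar>\<Sum>v\<in>e. \<nu> v\<bar> \<le> (\<Sum>v\<in>e. \<bar>\<nu> v\<bar>)"
    by (rule sum_abs)
  finally show ?thesis by simp
qed

text \<open>Removing \<open>e\<close> from a matching that uses it uncovers the two ends and divides
  the weight by \<open>exp (\<omega> e - (\<Sum>v\<in>e. \<nu> v))\<close>. This maps the matchings
  through \<open>e\<close> injectively to matchings without \<open>e\<close>, so their total is at
  most that factor times the partition function without \<open>e\<close>.\<close>

lemma partition_function_delete_edge:
  assumes G: "finite_simple_graph V E" and e: "e \<in> E"
  shows "partition_function V E \<nu> \<omega> \<le> exp (edge_cost \<nu> \<omega> e) * partition_function V (E - {e}) \<nu> \<omega>"
proof -
  let ?D = "{e'\<in>E. e' \<inter> e = {}}"
  have fin: "finite E" "finite V" and "e \<subseteq> V" "e \<noteq> {}"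
    using finite_simple_graph_finite_edges[OF G] finite_simple_graph_edgeD[OF G e] G
    by (auto simp: finite_simple_graph_def)
  have "exp (\<Sum>v\<in>e. \<nu> v) * partition_function (V - e) ?D \<nu> \<omega> = partition_function V ?D \<nu> \<omega>"
    using \<open>finite V\<close> \<open>e \<subseteq> V\<close> by (intro partition_function_isolated[symmetric]) auto
  also have "\<dots> \<le> partition_function V (E - {e}) \<nu> \<omega>"
    using fin \<open>e \<noteq> {}\<close> by (intro partition_function_mono) auto
  finally have "partition_function (V - e) ?D \<nu> \<omega>
      \<le> exp (- (\<Sum>v\<in>e. \<nu> v)) * partition_function V (E - {e}) \<nu> \<omega>"
    by (simp add: exp_minus field_simps)
  then have "exp (\<omega> e) * partition_function (V - e) ?D \<nu> \<omega>
      \<le> exp (\<omega> e) * (exp (- (\<Sum>v\<in>e. \<nu> v)) * partition_function V (E - {e}) \<nu> \<omega>)"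
    by (intro mult_left_mono) auto
  also have "\<dots> = exp (\<omega> e - (\<Sum>v\<in>e. \<nu> v)) * partition_function V (E - {e}) \<nu> \<omega>"
    by (simp add: exp_diff exp_minus field_simps)
  finally have "partition_function V E \<nu> \<omega>
      \<le> (1 + exp (\<omega> e - (\<Sum>v\<in>e. \<nu> v))) * partition_function V (E - {e}) \<nu> \<omega>"
    unfolding partition_function_edge[OF assms, of \<nu> \<omega>] by (simp add: algebra_simps)
  then show ?thesis
    by (simp add: edge_cost_def add_pos_pos)
qed

lemma partition_function_delete_edges:
  assumes G: "finite_simple_graph V E" and F: "F \<subseteq> E"
  shows "partition_function V E \<nu> \<omega> \<le> exp (\<Sum>e\<in>F. edge_cost \<nu> \<omega> e) * partition_function V (E - F) \<nu> \<omega>"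
proof -
  have "finite F"
    using F finite_simple_graph_finite_edges[OF G] by (rule finite_subset)
  then show ?thesis using F
  proof (induction F rule: finite_induct)
    case empty
    then show ?case by simp
  next
    case (insert e F)
    have "partition_function V (E - F) \<nu> \<omega>
        \<le> exp (edge_cost \<nu> \<omega> e) * partition_function V (E - F - {e}) \<nu> \<omega>"
      using insert by (intro partition_function_delete_edge finite_simple_graph_subset[OF G]) auto
    then have "exp (\<Sum>e\<in>F. edge_cost \<nu> \<omega> e) * partition_function V (E - F) \<nu> \<omega>
        \<le> exp (\<Sum>e\<in>F. edge_cost \<nu> \<omega> e)
          * (exp (edge_cost \<nu> \<omega> e) * partition_function V (E - F - {e}) \<nu> \<omega>)"
      by (intro mult_left_mono) auto
    moreover have "E - F - {e} = E - insert e F" by auto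
    moreover have "partition_function V E \<nu> \<omega>
        \<le> exp (\<Sum>e\<in>F. edge_cost \<nu> \<omega> e) * partition_function V (E - F) \<nu> \<omega>"
      using insert by simp
    ultimately have "partition_function V E \<nu> \<omega> \<le> exp (\<Sum>e\<in>F. edge_cost \<nu> \<omega> e)
          * (exp (edge_cost \<nu> \<omega> e) * partition_function V (E - insert e F) \<nu> \<omega>)"
      by (metis order_trans)
    then show ?case
      using insert.hyps by (simp add: exp_add mult_ac)
  qed
qed

text \<open>Edges are nonempty, so none belongs to both parts; a matching of the union is then a
  unique pair of matchings, and the Hamiltonian is additive over the pair.\<close>

lemma partition_function_disjoint_union:
  assumes GA: "finite_simple_graph A EA" and GB: "finite_simple_graph B EB"
    and AB: "A \<inter> B = {}"
  shows "partition_function (A \<union> B) (EA \<union> EB) \<nu> \<omega>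
    = partition_function A EA \<nu> \<omega> * partition_function B EB \<nu> \<omega>"
proof -
  have fin: "finite A" "finite B" "finite EA" "finite EB"
    using GA GB finite_simple_graph_finite_edges by (auto simp: finite_simple_graph_def)
  have EA: "e \<subseteq> A" "e \<noteq> {}" if "e \<in> EA" for e
    using finite_simple_graph_edgeD[OF GA that] by auto
  have EB: "e \<subseteq> B" "e \<noteq> {}" if "e \<in> EB" for e
    using finite_simple_graph_edgeD[OF GB that] by auto
  have EAB: "EA \<inter> EB = {}"
    using EA EB AB by blast
  have bij: "bij_betw (\<lambda>(k, l). k \<union> l) (matchings EA \<times> matchings EB) (matchings (EA \<union> EB))"
  proof (rule bij_betw_byWitness[where f' = "\<lambda>m. (m \<inter> EA, m \<inter> EB)"])
    show "\<forall>m\<in>matchings (EA \<union> EB). (case (m \<inter> EA, m \<inter> EB) of (k, l) \<Rightarrow> k \<union> l) = m"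
      by (auto simp: matchings_def)
    show "\<forall>a\<in>matchings EA \<times> matchings EB.
        ((case a of (k, l) \<Rightarrow> k \<union> l) \<inter> EA, (case a of (k, l) \<Rightarrow> k \<union> l) \<inter> EB) = a"
      using EAB by (auto simp: matchings_def)
    show "(\<lambda>m. (m \<inter> EA, m \<inter> EB)) ` matchings (EA \<union> EB) \<subseteq> matchings EA \<times> matchings EB"
      by (auto simp: matchings_def disjoint_def)
    show "(\<lambda>(k, l). k \<union> l) ` (matchings EA \<times> matchings EB) \<subseteq> matchings (EA \<union> EB)"
    proof clarify
      fix k l assume "k \<in> matchings EA" "l \<in> matchings EB"
      then have kl: "k \<subseteq> EA" "l \<subseteq> EB" "disjoint k" "disjoint l"
        by (auto simp: matchings_def)
      then have "\<Union>k \<inter> \<Union>l = {}"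
        using EA(1) EB(1) AB by blast
      then have "disjoint (k \<union> l)"
        using kl by (intro disjoint_union) auto
      then show "k \<union> l \<in> matchings (EA \<union> EB)"
        using kl by (auto simp: matchings_def)
    qed
  qed
  have ham: "hamiltonian (A \<union> B) \<nu> \<omega> (k \<union> l) = hamiltonian A \<nu> \<omega> k + hamiltonian B \<nu> \<omega> l"
    if "k \<in> matchings EA" "l \<in> matchings EB" for k l
  proof -
    have kl: "k \<subseteq> EA" "l \<subseteq> EB" using that by (auto simp: matchings_def)
    have sub: "\<Union>k \<subseteq> A" "\<Union>l \<subseteq> B" using kl EA(1) EB(1) by blast+
    have V: "A \<union> B - \<Union>(k \<union> l) = (A - \<Union>k) \<union> (B - \<Union>l)" "(A - \<Union>k) \<inter> (B - \<Union>l) = {}"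
      using sub AB by auto
    have "k \<inter> l = {}" "finite k" "finite l"
      using kl EAB fin by (auto intro: finite_subset)
    then show ?thesis
      unfolding hamiltonian_def V(1) using fin V(2) by (simp add: sum.union_disjoint)
  qed
  have "partition_function (A \<union> B) (EA \<union> EB) \<nu> \<omega>
      = (\<Sum>(k, l)\<in>matchings EA \<times> matchings EB. exp (hamiltonian (A \<union> B) \<nu> \<omega> (k \<union> l)))"
    unfolding partition_function_def
    by (subst sum.reindex_bij_betw[OF bij, symmetric]) (simp add: case_prod_unfold)
  also have "\<dots> = (\<Sum>(k, l)\<in>matchings EA \<times> matchings EB.
      exp (hamiltonian A \<nu> \<omega> k) * exp (hamiltonian B \<nu> \<omega> l))"
    by (intro sum.cong refl) (auto simp: ham exp_add)
  also have "\<dots> = partition_function A EA \<nu> \<omega> * partition_function B EB \<nu> \<omega>"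
    by (simp add: partition_function_def sum_product sum.cartesian_product)
  finally show ?thesis .
qed

lemma partition_function_image:
  assumes G: "finite_simple_graph V E" and f: "inj f"
  shows "partition_function (f ` V) ((`) f ` E) \<nu> \<omega> = partition_function V E (\<nu> \<circ> f) (\<omega> \<circ> (`) f)"
proof -
  have injI: "inj ((`) f)"
    using f by (simp add: inj_image_eq_iff inj_on_def)
  have injII: "inj ((`) ((`) f))"
    using injI by (simp add: inj_image_eq_iff inj_on_def)
  have dis: "disjoint ((`) f ` m) \<longleftrightarrow> disjoint m" for m
    using f by (auto simp: disjoint_def inj_image_eq_iff simp flip: image_Int)
  have "matchings ((`) f ` E) = (`) ((`) f) ` matchings E"
    unfolding matchings_def using dis by (auto simp: subset_image_iff image_iff)
  moreover have "hamiltonian (f ` V) \<nu> \<omega> ((`) f ` m) = hamiltonian V (\<nu> \<circ> f) (\<omega> \<circ> (`) f) m" for m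
  proof -
    have "f ` V - \<Union>((`) f ` m) = f ` (V - \<Union>m)"
      using f by (simp add: image_set_diff image_Union)
    moreover have "inj_on f (V - \<Union>m)" "inj_on ((`) f) m"
      using f injI by (auto intro: inj_on_subset)
    ultimately show ?thesis
      by (simp add: hamiltonian_def sum.reindex)
  qed
  ultimately show ?thesis
    unfolding partition_function_def
    by (simp add: sum.reindex inj_on_subset[OF injII subset_UNIV] comp_def)
qed

text \<open>Matchings that leave \<open>v\<close> uncovered carry the factor \<open>exp x\<close>
  and give \<open>a\<close>; the others do not see \<open>x\<close> and give \<open>b\<close>. To
  compare them, \<open>x\<close> is set to 0 and all edges at \<open>v\<close> are deleted, which
  leaves exactly \<open>a\<close>. Evaluating the costs at weight 0 keeps the bound on
  \<open>b / a\<close> free of the weight of \<open>v\<close>.\<close>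

lemma partition_function_affine_vertex:
  assumes G: "finite_simple_graph V E" and v: "v \<in> V"
  obtains a b where "0 < a" "0 \<le> b"
    "\<And>x. partition_function V E (\<nu>(v := x)) \<omega> = a * exp x + b"
    "b \<le> exp (\<Sum>e\<in>{e\<in>E. v \<in> e}. edge_cost (\<nu>(v := 0)) \<omega> e) * a"
proof -
  let ?S = "{e\<in>E. v \<in> e}"
  define a where "a = partition_function (V - {v}) (E - ?S) \<nu> \<omega>"
  define b where "b = (\<Sum>m\<in>{m\<in>matchings E. v \<in> \<Union>m}. exp (hamiltonian V \<nu> \<omega> m))"
  have fin: "finite E" "finite V"
    using finite_simple_graph_finite_edges[OF G] G by (auto simp: finite_simple_graph_def)
  have "0 < a" "0 \<le> b"
    using fin by (auto simp: a_def b_def intro!: partition_function_pos sum_nonneg)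
  have isolated: "partition_function V (E - ?S) (\<nu>(v := x)) \<omega> = a * exp x" for x
  proof -
    have "partition_function V (E - ?S) (\<nu>(v := x)) \<omega>
        = exp (\<Sum>u\<in>{v}. (\<nu>(v := x)) u) * partition_function (V - {v}) (E - ?S) (\<nu>(v := x)) \<omega>"
      using fin v by (intro partition_function_isolated) auto
    also have "partition_function (V - {v}) (E - ?S) (\<nu>(v := x)) \<omega> = a"
      unfolding a_def by (intro partition_function_cong) auto
    finally show ?thesis
      by (simp add: mult.commute del: fun_upd_apply fun_upd_same) simp
  qed
  have eq: "partition_function V E (\<nu>(v := x)) \<omega> = a * exp x + b" for x
  proof -
    have "partition_function V E (\<nu>(v := x)) \<omega>
        = (\<Sum>m\<in>matchings (E - ?S). exp (hamiltonian V (\<nu>(v := x)) \<omega> m))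
        + (\<Sum>m\<in>{m\<in>matchings E. v \<in> \<Union>m}. exp (hamiltonian V (\<nu>(v := x)) \<omega> m))"
      unfolding partition_function_def using fin
      by (subst sum.union_disjoint[symmetric]) (auto simp: matchings_def intro!: sum.cong)
    also have "(\<Sum>m\<in>{m\<in>matchings E. v \<in> \<Union>m}. exp (hamiltonian V (\<nu>(v := x)) \<omega> m)) = b"
      unfolding b_def hamiltonian_def
      by (intro sum.cong refl arg_cong[where f = exp] arg_cong2[where f = "(+)"]) auto
    finally show ?thesis
      using isolated[of x] by (simp only: partition_function_def)
  qed
  have "a + b \<le> exp (\<Sum>e\<in>?S. edge_cost (\<nu>(v := 0)) \<omega> e) * a"
    using partition_function_delete_edges[OF G, of ?S "\<nu>(v := 0)" \<omega>] isolated[of 0] eq[of 0]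
    by simp
  then show ?thesis
    using that[OF \<open>0 < a\<close> \<open>0 \<le> b\<close> eq] \<open>0 < a\<close> by simp
qed

text \<open>Here \<open>a\<close> collects the matchings through \<open>e\<close>, and
  \<open>b\<close> those without it. Deleting from the latter graph all other edges that touch
  \<open>e\<close> isolates both ends, which then contribute the factor
  \<open>exp (\<Sum>v\<in>e. \<nu> v)\<close> in front of \<open>a\<close>. The weight of
  \<open>e\<close> itself never enters the comparison.\<close>

lemma partition_function_affine_edge:
  assumes G: "finite_simple_graph V E" and e: "e \<in> E"
  obtains a b where "0 < a" "0 \<le> b"
    "\<And>x. partition_function V E \<nu> (fun_upd \<omega> e x) = a * exp x + b"
    "b \<le> exp ((\<Sum>v\<in>e. \<nu> v) + (\<Sum>e'\<in>{e'\<in>E - {e}. e' \<inter> e \<noteq> {}}. edge_cost \<nu> \<omega> e')) * a"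
proof -
  let ?D = "{e'\<in>E. e' \<inter> e = {}}" and ?S = "{e'\<in>E - {e}. e' \<inter> e \<noteq> {}}"
  define a where "a = partition_function (V - e) ?D \<nu> \<omega>"
  define b where "b = partition_function V (E - {e}) \<nu> \<omega>"
  have fin: "finite E" "finite V" and e': "e \<subseteq> V" "e \<noteq> {}"
    using finite_simple_graph_finite_edges[OF G] G finite_simple_graph_edgeD[OF G e]
    by (auto simp: finite_simple_graph_def)
  have "0 < a" "0 \<le> b"
    using fin by (auto simp: a_def b_def intro!: partition_function_pos less_imp_le)
  have eq: "partition_function V E \<nu> (fun_upd \<omega> e x) = a * exp x + b" for x
  proof -
    have "partition_function (V - e) ?D \<nu> (fun_upd \<omega> e x) = a"
      unfolding a_def using e' by (intro partition_function_cong) auto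
    moreover have "partition_function V (E - {e}) \<nu> (fun_upd \<omega> e x) = b"
      unfolding b_def by (intro partition_function_cong) auto
    ultimately show ?thesis
      using partition_function_edge[OF assms, of \<nu> "fun_upd \<omega> e x"] by simp
  qed
  have "b \<le> exp (\<Sum>e'\<in>?S. edge_cost \<nu> \<omega> e') * partition_function V (E - {e} - ?S) \<nu> \<omega>"
    unfolding b_def
    by (intro partition_function_delete_edges finite_simple_graph_subset[OF G]) auto
  also have "E - {e} - ?S = ?D" using e' by auto
  also have "partition_function V ?D \<nu> \<omega> = exp (\<Sum>v\<in>e. \<nu> v) * a"
    unfolding a_def using fin e' by (intro partition_function_isolated) auto
  finally show ?thesis
    using that[OF \<open>0 < a\<close> \<open>0 \<le> b\<close> eq] by (simp add: exp_add mult_ac)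
qed

section \<open>Square-integrable random variables\<close>

text \<open>The least value of \<open>(y - m) * (ln (a * exp y + b) - ln (a * exp m + b))\<close>
  over \<open>0 < a\<close> and \<open>0 <= b <= t * a\<close>, attained at
  \<open>b = t * a\<close>, where \<open>a\<close> cancels.\<close>

definition log_gap :: "real \<Rightarrow> real \<Rightarrow> real \<Rightarrow> real" where
  "log_gap t m y = (y - m) * (ln (exp y + t) - ln (exp m + t))"

text \<open>For \<open>x <= y\<close> the quotient of \<open>a * exp y + b\<close> by
  \<open>a * exp x + b\<close> decreases in \<open>b / a\<close>. The two bounds are its values at
  the extreme ratios \<open>t\<close> and 0.\<close>

lemma ln_affine_diff_bounds:
  fixes a b t x y :: real
  assumes "0 < a" "0 \<le> b" "b \<le> t * a" "x \<le> y"
  shows "ln (exp y + t) - ln (exp x + t) \<le> ln (a * exp y + b) - ln (a * exp x + b)"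
    and "ln (a * exp y + b) - ln (a * exp x + b) \<le> y - x"
proof -
  have t: "0 \<le> t"
    using assms by (metis dual_order.trans zero_le_mult_iff linorder_not_less)
  have pos: "0 < exp y + t" "0 < exp x + t" "0 < a * exp y + b" "0 < a * exp x + b"
    using t assms by (auto intro!: add_pos_nonneg)
  have "0 \<le> (exp y - exp x) * (t * a - b)"
    using assms by simp
  then have "(exp y + t) * (a * exp x + b) \<le> (a * exp y + b) * (exp x + t)"
    by (simp add: algebra_simps)
  then have "ln ((exp y + t) * (a * exp x + b)) \<le> ln ((a * exp y + b) * (exp x + t))"
    using pos by (intro ln_mono) auto
  then show "ln (exp y + t) - ln (exp x + t) \<le> ln (a * exp y + b) - ln (a * exp x + b)"
    using pos by (simp add: ln_mult)
  have "b * 1 \<le> b * exp (y - x)"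
    using assms by (intro mult_left_mono) auto
  then have "a * exp y + b \<le> exp (y - x) * (a * exp x + b)"
    by (simp add: algebra_simps exp_diff)
  then have "ln (a * exp y + b) \<le> ln (exp (y - x) * (a * exp x + b))"
    using pos by (intro ln_mono) auto
  also have "\<dots> = (y - x) + ln (a * exp x + b)"
    using pos by (subst ln_mult) auto
  finally show "ln (a * exp y + b) - ln (a * exp x + b) \<le> y - x"
    by simp
qed

lemma log_gap_le:
  assumes "0 < a" "0 \<le> b" "b \<le> t * a"
  shows "log_gap t m y \<le> (ln (a * exp y + b) - ln (a * exp m + b)) * (y - m)"
proof (cases "m \<le> y")
  case True
  then show ?thesis
    unfolding log_gap_def
    using mult_left_mono[OF ln_affine_diff_bounds(1)[OF assms True], of "y - m"]
    by (simp add: mult.commute)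
next
  case False
  then have "y \<le> m" by simp
  then show ?thesis
    unfolding log_gap_def
    using mult_left_mono[OF ln_affine_diff_bounds(1)[OF assms \<open>y \<le> m\<close>], of "m - y"]
    by (simp add: algebra_simps)
qed

lemma ln_affine_lipschitz:
  fixes a b x y :: real
  assumes "0 < a" "0 \<le> b"
  shows "\<bar>ln (a * exp y + b) - ln (a * exp x + b)\<bar> \<le> \<bar>y - x\<bar>"
proof -
  have *: "\<bar>ln (a * exp y + b) - ln (a * exp x + b)\<bar> \<le> \<bar>y - x\<bar>" if "x \<le> y" for x y
  proof -
    have "b \<le> b / a * a" using assms by simp
    then have "ln (a * exp y + b) - ln (a * exp x + b) \<le> y - x"
      using ln_affine_diff_bounds(2)[OF assms] that by blast
    moreover have "ln (a * exp x + b) \<le> ln (a * exp y + b)"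
      using assms that by (intro ln_mono) (auto intro!: add_pos_nonneg)
    ultimately show ?thesis by simp
  qed
  show ?thesis
    using *[of x y] *[of y x] by (cases "x \<le> y") (auto simp: abs_minus_commute)
qed

lemma log_gap_nonneg: "0 \<le> t \<Longrightarrow> 0 \<le> log_gap t m y"
  unfolding log_gap_def
  by (cases "m \<le> y")
    (auto intro!: mult_nonneg_nonneg mult_nonpos_nonpos add_pos_nonneg simp: add_pos_nonneg)

lemma log_gap_eq_0_iff: "0 \<le> t \<Longrightarrow> log_gap t m y = 0 \<longleftrightarrow> y = m"
  unfolding log_gap_def by (auto simp: add_pos_nonneg)

lemma log_gap_le_square:
  assumes "0 \<le> t"
  shows "log_gap t m y \<le> (y - m)\<^sup>2"
proof -
  have "log_gap t m y \<le> \<bar>y - m\<bar> * \<bar>ln (exp y + t) - ln (exp m + t)\<bar>"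
    unfolding log_gap_def abs_mult[symmetric] by simp
  also have "\<dots> \<le> \<bar>y - m\<bar> * \<bar>y - m\<bar>"
    using ln_affine_lipschitz[of 1 t y m] assms by (intro mult_left_mono) auto
  finally show ?thesis by (simp add: power2_eq_square)
qed

lemma borel_measurable_log_gap [measurable]: "log_gap t m \<in> borel_measurable borel"
  unfolding log_gap_def by measurable

section \<open>Second moments, standard deviation and covariance\<close>

definition sq_integrable :: "'a measure \<Rightarrow> ('a \<Rightarrow> real) \<Rightarrow> bool" where
  "sq_integrable M X \<longleftrightarrow> X \<in> borel_measurable M \<and> integrable M (\<lambda>x. (X x)\<^sup>2)"

lemma sq_integrable_mult:
  assumes "sq_integrable M X" "sq_integrable M Y"
  shows "integrable M (\<lambda>x. X x * Y x)"
proof (rule Bochner_Integration.integrable_bound)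
  show "integrable M (\<lambda>x. (X x)\<^sup>2 + (Y x)\<^sup>2)"
    using assms by (simp add: sq_integrable_def)
  show "(\<lambda>x. X x * Y x) \<in> borel_measurable M"
    using assms by (auto simp: sq_integrable_def)
  have "\<bar>x * y\<bar> \<le> x\<^sup>2 + y\<^sup>2" for x y :: real
  proof -
    have "2 * \<bar>x * y\<bar> \<le> x\<^sup>2 + y\<^sup>2"
      using sum_squares_bound[of "\<bar>x\<bar>" "\<bar>y\<bar>"] by (simp add: abs_mult mult.assoc)
    then show ?thesis using abs_ge_zero[of "x * y"] by linarith
  qed
  then show "AE x in M. norm (X x * Y x) \<le> norm ((X x)\<^sup>2 + (Y x)\<^sup>2)"
    by simp
qed

lemma sq_integrable_bound:
  assumes "sq_integrable M Y" "X \<in> borel_measurable M" "\<And>x. x \<in> space M \<Longrightarrow> \<bar>X x\<bar> \<le> Y x"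
  shows "sq_integrable M X"
  unfolding sq_integrable_def
proof
  show "integrable M (\<lambda>x. (X x)\<^sup>2)"
  proof (rule Bochner_Integration.integrable_bound)
    show "integrable M (\<lambda>x. (Y x)\<^sup>2)" using assms by (simp add: sq_integrable_def)
    show "(\<lambda>x. (X x)\<^sup>2) \<in> borel_measurable M" using assms(2) by simp
    show "AE x in M. norm ((X x)\<^sup>2) \<le> norm ((Y x)\<^sup>2)"
      using assms(3) by (intro AE_I2) (force simp: abs_le_square_iff[symmetric])
  qed
qed fact

lemma sq_integrable_add:
  assumes "sq_integrable M X" "sq_integrable M Y"
  shows "sq_integrable M (\<lambda>x. X x + Y x)"
  using assms sq_integrable_mult[OF assms]
  by (auto simp: sq_integrable_def power2_sum mult.assoc)

lemma sq_integrable_cmult: "sq_integrable M X \<Longrightarrow> sq_integrable M (\<lambda>x. c * X x)"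
  by (auto simp: sq_integrable_def power_mult_distrib)

lemma sq_integrable_diff:
  assumes "sq_integrable M X" "sq_integrable M Y"
  shows "sq_integrable M (\<lambda>x. X x - Y x)"
  using sq_integrable_add[OF assms(1) sq_integrable_cmult[OF assms(2), of "-1"]] by simp

lemma sq_integrable_abs: "sq_integrable M X \<Longrightarrow> sq_integrable M (\<lambda>x. \<bar>X x\<bar>)"
  by (auto simp: sq_integrable_def)

lemma sq_integrable_sum:
  "(\<And>i. i \<in> I \<Longrightarrow> sq_integrable M (X i)) \<Longrightarrow> sq_integrable M (\<lambda>x. \<Sum>i\<in>I. X i x)"
proof (induction I rule: infinite_finite_induct)
  case (insert i I)
  then show ?case by (simp add: sq_integrable_add)
qed (simp_all add: sq_integrable_def)

context prob_space
begin

lemma sq_integrable_const [simp]: "sq_integrable M (\<lambda>_. c)"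
  by (simp add: sq_integrable_def)

lemma sq_integrable_imp_integrable: "sq_integrable M X \<Longrightarrow> integrable M X"
  unfolding sq_integrable_def by (blast intro: square_integrable_imp_integrable)

text \<open>The second moment of \<open>X - t * Y\<close> is a nonnegative quadratic in
  \<open>t\<close>; it is evaluated at its minimiser \<open>b / c\<close>, and \<open>c = 0\<close>
  needs a separate argument.\<close>

lemma expectation_Cauchy_Schwarz:
  assumes X: "sq_integrable M X" and Y: "sq_integrable M Y"
  shows "(expectation (\<lambda>x. X x * Y x))\<^sup>2
    \<le> expectation (\<lambda>x. (X x)\<^sup>2) * expectation (\<lambda>x. (Y x)\<^sup>2)"
proof -
  define a b c where "a = expectation (\<lambda>x. (X x)\<^sup>2)" and "b = expectation (\<lambda>x. X x * Y x)"
    and "c = expectation (\<lambda>x. (Y x)\<^sup>2)"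
  have quad: "0 \<le> a - 2 * t * b + t\<^sup>2 * c" for t
  proof -
    have "(\<lambda>x. (X x - t * Y x)\<^sup>2) = (\<lambda>x. (X x)\<^sup>2 - 2 * t * (X x * Y x) + t\<^sup>2 * (Y x)\<^sup>2)"
      by (simp add: fun_eq_iff power2_eq_square algebra_simps)
    then have "expectation (\<lambda>x. (X x - t * Y x)\<^sup>2) = a - 2 * t * b + t\<^sup>2 * c"
      using X Y sq_integrable_mult[OF X Y] by (simp add: a_def b_def c_def sq_integrable_def)
    moreover have "0 \<le> expectation (\<lambda>x. (X x - t * Y x)\<^sup>2)" by simp
    ultimately show ?thesis by simp
  qed
  have "0 \<le> c" by (simp add: c_def)
  have "b\<^sup>2 \<le> a * c"
  proof (cases "c = 0")
    case True
    have "b = 0"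
    proof (rule ccontr)
      \<comment> \<open>With \<open>c = 0\<close> the quadratic is the linear function
        \<open>a - 2 * t * b\<close>, and the chosen \<open>t\<close> makes it equal to -1.\<close>
      assume "b \<noteq> 0"
      then have "2 * ((a + 1) / (2 * b)) * b = a + 1" by simp
      then show False
        using quad[of "(a + 1) / (2 * b)"] True by simp
    qed
    with True show ?thesis by simp
  next
    case False
    then show ?thesis
      using quad[of "b / c"] \<open>0 \<le> c\<close> by (simp add: field_simps power2_eq_square)
  qed
  then show ?thesis by (simp add: a_def b_def c_def)
qed

definition stdev :: "('a \<Rightarrow> real) \<Rightarrow> real" where
  "stdev X = sqrt (variance X)"

lemma stdev_nonneg [simp]: "0 \<le> stdev X"
  by (simp add: stdev_def)

lemma stdev_square: "(stdev X)\<^sup>2 = variance X"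
  by (simp add: stdev_def)

lemma sq_integrable_centered: "sq_integrable M X \<Longrightarrow> sq_integrable M (\<lambda>x. X x - c)"
  by (intro sq_integrable_diff sq_integrable_const)

lemma variance_add:
  assumes X: "sq_integrable M X" and Y: "sq_integrable M Y"
  shows "variance (\<lambda>x. X x + Y x) = variance X + variance Y
    + 2 * expectation (\<lambda>x. (X x - expectation X) * (Y x - expectation Y))"
proof -
  let ?X = "\<lambda>x. X x - expectation X" and ?Y = "\<lambda>x. Y x - expectation Y"
  have "expectation (\<lambda>x. X x + Y x) = expectation X + expectation Y"
    using X Y by (simp add: sq_integrable_imp_integrable)
  then have "variance (\<lambda>x. X x + Y x) = expectation (\<lambda>x. (?X x)\<^sup>2 + (?Y x)\<^sup>2 + 2 * (?X x * ?Y x))"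
    by (intro Bochner_Integration.integral_cong) (auto simp: power2_eq_square algebra_simps)
  moreover have "integrable M (\<lambda>x. (?X x)\<^sup>2)" "integrable M (\<lambda>x. (?Y x)\<^sup>2)"
    using sq_integrable_centered[OF X] sq_integrable_centered[OF Y]
    by (auto simp: sq_integrable_def)
  moreover have "integrable M (\<lambda>x. ?X x * ?Y x)"
    by (intro sq_integrable_mult sq_integrable_centered X Y)
  ultimately show ?thesis by simp
qed

lemma stdev_triangle:
  assumes X: "sq_integrable M X" and Y: "sq_integrable M Y"
  shows "stdev (\<lambda>x. X x + Y x) \<le> stdev X + stdev Y"
proof -
  let ?c = "expectation (\<lambda>x. (X x - expectation X) * (Y x - expectation Y))"
  have "?c\<^sup>2 \<le> variance X * variance Y"
    by (intro expectation_Cauchy_Schwarz sq_integrable_centered X Y)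
  then have "?c\<^sup>2 \<le> (stdev X * stdev Y)\<^sup>2"
    by (simp add: power_mult_distrib stdev_square)
  then have "?c \<le> stdev X * stdev Y"
    by (rule power2_le_imp_le) simp
  then have "(stdev (\<lambda>x. X x + Y x))\<^sup>2 \<le> (stdev X + stdev Y)\<^sup>2"
    by (simp add: power2_sum stdev_square variance_add[OF X Y])
  then show ?thesis
    by (rule power2_le_imp_le) simp
qed

lemma stdev_uminus: "stdev (\<lambda>x. - X x) = stdev X"
  by (simp add: stdev_def power2_commute)

lemma stdev_le_second_moment:
  assumes X: "sq_integrable M X"
  shows "stdev X \<le> sqrt (expectation (\<lambda>x. (X x)\<^sup>2))"
  using variance_eq[of X] X sq_integrable_imp_integrable[OF X]
  by (simp add: stdev_def sq_integrable_def)

text \<open>No independence between \<open>X\<close> and \<open>R\<close> is assumed: the standard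
  deviation is the \<open>L2\<close> norm of the centred variable, so the triangle inequality in
  both directions suffices.\<close>

lemma stdev_perturbation:
  assumes X: "sq_integrable M X" and R: "sq_integrable M R"
    and K: "expectation (\<lambda>x. (R x)\<^sup>2) \<le> K\<^sup>2" "0 \<le> K"
  shows "\<bar>stdev (\<lambda>x. X x + R x) - stdev X\<bar> \<le> K"
proof -
  have "stdev R \<le> sqrt (K\<^sup>2)"
    using stdev_le_second_moment[OF R] K(1) real_sqrt_le_mono order_trans by blast
  then have R': "stdev R \<le> K" using K(2) by simp
  have "stdev X \<le> stdev (\<lambda>x. X x + R x) + stdev (\<lambda>x. - R x)"
    using stdev_triangle[OF sq_integrable_add[OF X R] sq_integrable_cmult[OF R, of "-1"]] by simp
  then show ?thesis
    using R' stdev_triangle[OF X R] by (simp add: stdev_uminus)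
qed

lemma variance_add_indep:
  assumes X: "sq_integrable M X" and Y: "sq_integrable M Y" and ind: "indep_var borel X borel Y"
  shows "variance (\<lambda>x. X x + Y x) = variance X + variance Y"
proof -
  have int: "integrable M X" "integrable M Y"
    using X Y sq_integrable_imp_integrable by auto
  have "indep_var borel ((\<lambda>x. x - expectation X) \<circ> X) borel ((\<lambda>y. y - expectation Y) \<circ> Y)"
    by (rule indep_var_compose[OF ind]) auto
  then have "expectation (\<lambda>x. (X x - expectation X) * (Y x - expectation Y))
      = expectation (\<lambda>x. X x - expectation X) * expectation (\<lambda>x. Y x - expectation Y)"
    using int by (subst indep_var_lebesgue_integral[symmetric]) (auto simp: comp_def)
  also have "\<dots> = 0" using int by (simp add: prob_space)
  finally show ?thesis by (simp add: variance_add[OF X Y])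
qed

text \<open>Cauchy--Schwarz applied to \<open>X\<close> and \<open>\<Sum>i\<in>I. Y i - m\<close>.\<close>

lemma variance_lower_bound:
  fixes c :: real
  assumes X: "sq_integrable M X" and I: "finite I" "I \<noteq> {}"
    and Y: "\<And>i. i \<in> I \<Longrightarrow> sq_integrable M (Y i)"
    and m: "\<And>i. i \<in> I \<Longrightarrow> expectation (Y i) = m"
    and t: "\<And>i. i \<in> I \<Longrightarrow> variance (Y i) = t"
    and ind: "\<And>i j. i \<in> I \<Longrightarrow> j \<in> I \<Longrightarrow> i \<noteq> j \<Longrightarrow> indep_var borel (Y i) borel (Y j)"
    and cov: "\<And>i. i \<in> I \<Longrightarrow> c \<le> expectation (\<lambda>x. X x * (Y i x - m))" and c: "0 \<le> c"
  shows "card I * c\<^sup>2 \<le> t * variance X"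
proof -
  define S where "S x = (\<Sum>i\<in>I. Y i x - m)" for x
  have cen: "sq_integrable M (\<lambda>x. Y i x - m)" if "i \<in> I" for i
    using Y[OF that] by (rule sq_integrable_centered)
  have S: "sq_integrable M S"
    unfolding S_def[abs_def] by (intro sq_integrable_sum cen)
  have int: "integrable M (Y i)" if "i \<in> I" for i
    using Y[OF that] by (rule sq_integrable_imp_integrable)
  have ES: "expectation S = 0"
    unfolding S_def[abs_def] using int m by (simp add: prob_space)
  have cross: "expectation (\<lambda>x. (Y i x - m) * (Y j x - m)) = (if i = j then t else 0)"
    if ij: "i \<in> I" "j \<in> I" for i j
  proof (cases "i = j")
    case True
    then show ?thesis using t[OF ij(1)] m[OF ij(1)] by (simp add: power2_eq_square)
  next
    case False
    have "indep_var borel ((\<lambda>x. x - m) \<circ> Y i) borel ((\<lambda>x. x - m) \<circ> Y j)"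
      by (rule indep_var_compose[OF ind[OF ij False]]) auto
    then have "expectation (\<lambda>x. (Y i x - m) * (Y j x - m))
        = expectation (\<lambda>x. Y i x - m) * expectation (\<lambda>x. Y j x - m)"
      using int ij by (subst indep_var_lebesgue_integral[symmetric]) (auto simp: comp_def)
    also have "\<dots> = 0" using int[OF ij(1)] m[OF ij(1)] by (simp add: prob_space)
    finally show ?thesis using False by simp
  qed
  have "expectation (\<lambda>x. (S x)\<^sup>2) = expectation (\<lambda>x. \<Sum>i\<in>I. \<Sum>j\<in>I. (Y i x - m) * (Y j x - m))"
    by (simp add: S_def power2_eq_square sum_product)
  also have "\<dots> = (\<Sum>i\<in>I. \<Sum>j\<in>I. expectation (\<lambda>x. (Y i x - m) * (Y j x - m)))"
    by (subst Bochner_Integration.integral_sum)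
      (auto intro!: sum.cong Bochner_Integration.integral_sum sq_integrable_mult cen)
  also have "\<dots> = card I * t"
    using I by (simp add: cross cong: sum.cong)
  finally have ES2: "expectation (\<lambda>x. (S x)\<^sup>2) = card I * t" .
  have Xcen: "sq_integrable M (\<lambda>x. X x - expectation X)"
    using X by (rule sq_integrable_centered)
  have "card I * c \<le> (\<Sum>i\<in>I. expectation (\<lambda>x. X x * (Y i x - m)))"
    using sum_mono[OF cov] by simp
  also have "\<dots> = expectation (\<lambda>x. X x * S x)"
    unfolding S_def sum_distrib_left using X cen
    by (intro Bochner_Integration.integral_sum[symmetric] sq_integrable_mult)
  \<comment> \<open>Centring \<open>X\<close> changes nothing because \<open>S\<close> has mean 0;
    it replaces the second moment of \<open>X\<close> by its variance in the Cauchy-Schwarz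
    bound.\<close>
  also have "\<dots> = expectation (\<lambda>x. (X x - expectation X) * S x)"
    using sq_integrable_mult[OF X S] sq_integrable_imp_integrable[OF S] ES
    by (simp add: left_diff_distrib)
  finally have "(card I * c)\<^sup>2 \<le> (expectation (\<lambda>x. (X x - expectation X) * S x))\<^sup>2"
    using c by (intro power_mono) auto
  also have "\<dots> \<le> variance X * (card I * t)"
    using expectation_Cauchy_Schwarz[OF Xcen S] ES2 by simp
  finally have "card I * (card I * c\<^sup>2) \<le> card I * (t * variance X)"
    by (simp add: power2_eq_square mult_ac)
  moreover have "0 < real (card I)"
    using I by (simp add: card_gt_0_iff)
  ultimately show ?thesis
    by (simp only: mult_le_cancel_left_pos)
qed

text \<open>Here \<open>X0\<close> is \<open>X\<close> with \<open>Y\<close> replaced by its mean; it is uncorrelated with \<open>Y\<close>, so that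
  the covariance of \<open>X\<close> and \<open>Y\<close> is the expectation of \<open>(X - X0) * (Y - m)\<close>, which is nonnegative.\<close>

lemma covariance_log_affine:
  assumes X: "sq_integrable M X" and Y: "sq_integrable M Y" and m: "expectation Y = m"
    and indX0: "indep_var borel X0 borel Y" and indL: "indep_var borel L borel Y"
    and L: "integrable M L" "\<And>x. x \<in> space M \<Longrightarrow> 0 \<le> L x" "expectation L \<le> k" "0 < k"
    and affine: "\<And>x. x \<in> space M \<Longrightarrow> \<exists>a b. 0 < a \<and> 0 \<le> b \<and> b \<le> exp (L x) * a
      \<and> X x = ln (a * exp (Y x) + b) \<and> X0 x = ln (a * exp m + b)"
  shows "expectation (\<lambda>x. log_gap (exp (2 * k)) m (Y x)) / 2 \<le> expectation (\<lambda>x. X x * (Y x - m))"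
proof -
  let ?t = "exp (2 * k)"
  let ?g = "\<lambda>x. indicator {..2 * k} (L x) :: real"
  have [measurable]: "X0 \<in> borel_measurable M" "L \<in> borel_measurable M" "Y \<in> borel_measurable M"
    "X \<in> borel_measurable M"
    using indep_var_rv1[OF indX0] indep_var_rv1[OF indL] X Y by (auto simp: sq_integrable_def)
  have cen: "sq_integrable M (\<lambda>x. Y x - m)"
    using Y by (rule sq_integrable_centered)
  have "sq_integrable M (\<lambda>x. X0 x - X x)"
  proof (rule sq_integrable_bound[OF sq_integrable_abs[OF cen]])
    fix x assume "x \<in> space M"
    then show "\<bar>X0 x - X x\<bar> \<le> \<bar>Y x - m\<bar>"
      using affine ln_affine_lipschitz by (metis abs_minus_commute)
  qed simp
  from sq_integrable_add[OF X this] have X0: "sq_integrable M X0" by simp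
  have gap_int: "integrable M (\<lambda>x. log_gap ?t m (Y x))"
  proof (rule Bochner_Integration.integrable_bound)
    show "integrable M (\<lambda>x. (Y x - m)\<^sup>2)" using cen by (simp add: sq_integrable_def)
    show "AE x in M. norm (log_gap ?t m (Y x)) \<le> norm ((Y x - m)\<^sup>2)"
      using log_gap_le_square[of ?t m] log_gap_nonneg[of ?t m] by simp
  qed simp
  have g_int: "integrable M ?g"
    by (rule integrable_const_bound[of _ 1]) auto
  \<comment> \<open>Markov's inequality: \<open>1 - L / (2 * k)\<close> is at most the indicator of
    \<open>L <= 2 * k\<close>, so this event has probability at least 1/2. This is the origin of the
    factor 1/2 in the conclusion.\<close>
  have "1 - expectation L / (2 * k) = expectation (\<lambda>x. 1 - L x / (2 * k))"
    using L by (simp add: prob_space)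
  also have "\<dots> \<le> expectation ?g"
    using L g_int by (intro integral_mono) (auto simp: indicator_def field_simps)
  finally have "1 - expectation L / (2 * k) \<le> expectation ?g" .
  moreover have "expectation L / (2 * k) \<le> 1 / 2"
    using L by (simp add: field_simps)
  ultimately have "1 / 2 \<le> expectation ?g"
    by simp
  then have "1 / 2 * expectation (\<lambda>x. log_gap ?t m (Y x))
      \<le> expectation ?g * expectation (\<lambda>x. log_gap ?t m (Y x))"
    by (intro mult_right_mono Bochner_Integration.integral_nonneg log_gap_nonneg) auto
  also have "\<dots> = expectation (\<lambda>x. ?g x * log_gap ?t m (Y x))"
  proof -
    have "indep_var borel (indicator {..2 * k} \<circ> L) borel (log_gap ?t m \<circ> Y)"
      by (rule indep_var_compose[OF indL]) auto
    then show ?thesis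
      using g_int gap_int by (subst indep_var_lebesgue_integral[symmetric]) (auto simp: comp_def)
  qed
  also have "\<dots> \<le> expectation (\<lambda>x. (X x - X0 x) * (Y x - m))"
  proof (rule integral_mono)
    have "indep_var borel (indicator {..2 * k} \<circ> L) borel (log_gap ?t m \<circ> Y)"
      by (rule indep_var_compose[OF indL]) auto
    then show "integrable M (\<lambda>x. ?g x * log_gap ?t m (Y x))"
      using indep_var_integrable g_int gap_int by (fastforce simp: comp_def)
    show "integrable M (\<lambda>x. (X x - X0 x) * (Y x - m))"
      by (intro sq_integrable_mult sq_integrable_diff X X0 cen)
    fix x assume "x \<in> space M"
    then obtain a b where ab: "0 < a" "0 \<le> b" "b \<le> exp (L x) * a"
      "X x = ln (a * exp (Y x) + b)" "X0 x = ln (a * exp m + b)"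
      using affine by blast
    have le: "log_gap s m (Y x) \<le> (X x - X0 x) * (Y x - m)" if "b \<le> s * a" for s
      using log_gap_le[OF ab(1,2) that] ab(4,5) by simp
    \<comment> \<open>Where \<open>L <= 2 * k\<close>, the ratio \<open>b / a\<close> is at most
      \<open>exp (2 * k)\<close> and the gap is a valid lower bound. Elsewhere the left side is 0,
      and only nonnegativity of the right side is required.\<close>
    show "?g x * log_gap ?t m (Y x) \<le> (X x - X0 x) * (Y x - m)"
    proof (cases "L x \<le> 2 * k")
      case True
      then have "exp (L x) * a \<le> ?t * a" using ab(1) by simp
      with ab(3) have "b \<le> ?t * a" by linarith
      then show ?thesis using le True by simp
    next
      case False
      have "0 \<le> log_gap (exp (L x)) m (Y x)" by (intro log_gap_nonneg) simp
      with le[OF ab(3)] False show ?thesis by simp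
    qed
  qed
  also have "\<dots> = expectation (\<lambda>x. X x * (Y x - m)) - expectation (\<lambda>x. X0 x * (Y x - m))"
    using sq_integrable_mult[OF X cen] sq_integrable_mult[OF X0 cen] by (simp add: left_diff_distrib)
  also have "expectation (\<lambda>x. X0 x * (Y x - m)) = expectation X0 * expectation (\<lambda>x. Y x - m)"
  proof -
    have "indep_var borel ((\<lambda>x. x) \<circ> X0) borel ((\<lambda>x. x - m) \<circ> Y)"
      by (rule indep_var_compose[OF indX0]) auto
    then show ?thesis
      using sq_integrable_imp_integrable[OF X0] sq_integrable_imp_integrable[OF cen]
      by (subst indep_var_lebesgue_integral[symmetric]) (auto simp: comp_def)
  qed
  also have "expectation (\<lambda>x. Y x - m) = 0"
    using sq_integrable_imp_integrable[OF Y] m by (simp add: prob_space)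
  finally show ?thesis by simp
qed

end

text \<open>A nonnegative integrand with integral 0 vanishes almost everywhere, and
  \<open>log_gap t m\<close> vanishes only at \<open>m\<close>; the law would then be a point mass.
  This is where nondegeneracy enters.\<close>

lemma expectation_log_gap_pos:
  assumes "real_distribution D" "sq_integrable D (\<lambda>x. x)" "\<not> degenerate_law D" "0 \<le> t"
  shows "0 < (\<integral>x. log_gap t m x \<partial>D)"
proof -
  interpret D: real_distribution D by fact
  have cen: "sq_integrable D (\<lambda>x. x - m)"
    using assms(2) by (rule D.sq_integrable_centered)
  have int: "integrable D (log_gap t m)"
  proof (rule Bochner_Integration.integrable_bound)
    show "integrable D (\<lambda>x. (x - m)\<^sup>2)" using cen by (simp add: sq_integrable_def)
    show "AE x in D. norm (log_gap t m x) \<le> norm ((x - m)\<^sup>2)"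
      using log_gap_le_square[OF assms(4), of m] log_gap_nonneg[OF assms(4), of m] by simp
  qed simp
  have "(\<integral>x. log_gap t m x \<partial>D) \<noteq> 0"
  proof
    assume "(\<integral>x. log_gap t m x \<partial>D) = 0"
    then have "AE x in D. log_gap t m x = 0"
      using integral_nonneg_eq_0_iff_AE[OF int] log_gap_nonneg[OF assms(4), of m] by simp
    then have "AE x in D. x = m"
      using log_gap_eq_0_iff[OF assms(4), of m] by simp
    then show False
      using assms(3) by (auto simp: degenerate_law_def)
  qed
  moreover have "0 \<le> (\<integral>x. log_gap t m x \<partial>D)"
    by (intro Bochner_Integration.integral_nonneg log_gap_nonneg assms(4))
  ultimately show ?thesis by simp
qed

section \<open>Cutting a cylinder\<close>

definition translate :: "nat \<Rightarrow> nat \<times> 'v \<Rightarrow> nat \<times> 'v" where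
  "translate a = map_prod (\<lambda>i. i + a) id"

definition rung :: "nat \<Rightarrow> 'v \<Rightarrow> (nat \<times> 'v) set" where
  "rung i j = {(i, j), (i + 1, j)}"

lemma translate_apply [simp]: "translate a (i, j) = (i + a, j)"
  by (simp add: translate_def)

lemma inj_translate: "inj (translate a)"
  unfolding translate_def by (intro prod.inj_map) (auto intro: injI)

lemma rung_eq_iff: "rung i j = rung i' j' \<longleftrightarrow> i = i' \<and> j = j'"
  by (auto simp: rung_def doubleton_eq_iff)

lemma translate_rung: "translate a ` rung i j = rung (i + a) j"
  by (simp add: rung_def)

lemma cylinder_edges_eq:
  "cylinder_edges VH EH n = {rung i j | i j. 1 \<le> i \<and> i < n \<and> j \<in> VH}
    \<union> {{(i, j), (i, j')} | i j j'. 1 \<le> i \<and> i \<le> n \<and> j \<in> VH \<and> j' \<in> VH \<and> {j, j'} \<in> EH}"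
  (is "?L = ?R1 \<union> ?R2")
proof (intro equalityI subsetI)
  fix e assume "e \<in> ?L"
  then obtain i j i' j' where e: "e = {(i, j), (i', j')}" "i \<in> {1..n}" "i' \<in> {1..n}"
      "j \<in> VH" "j' \<in> VH" "{i, i'} \<in> line_edges n \<and> j = j' \<or> i = i' \<and> {j, j'} \<in> EH"
    unfolding cylinder_edges_def cartesian_product_edges_def by blast
  from e(6) show "e \<in> ?R1 \<union> ?R2"
  proof
    assume "i = i' \<and> {j, j'} \<in> EH"
    then have "e \<in> ?R2" using e by auto
    then show ?thesis ..
  next
    assume *: "{i, i'} \<in> line_edges n \<and> j = j'"
    then obtain k where k: "{i, i'} = {k, k + 1}" "1 \<le> k" "k < n"
      unfolding line_edges_def by auto
    then have "e = rung k j"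
      using e(1) * by (auto simp: rung_def doubleton_eq_iff)
    then have "e \<in> ?R1" using k e by blast
    then show ?thesis ..
  qed
next
  fix e assume "e \<in> ?R1 \<union> ?R2"
  then show "e \<in> ?L"
  proof
    assume "e \<in> ?R1"
    then obtain i j where "e = {(i, j), (i + 1, j)}" "1 \<le> i" "i < n" "j \<in> VH"
      unfolding rung_def by blast
    moreover have "{i, i + 1} \<in> line_edges n"
      using calculation unfolding line_edges_def by blast
    moreover have "i \<in> {1..n}" "i + 1 \<in> {1..n}"
      using calculation by auto
    ultimately show ?thesis
      unfolding cylinder_edges_def cartesian_product_edges_def by blast
  next
    assume "e \<in> ?R2"
    then obtain i j j' where "e = {(i, j), (i, j')}" "i \<in> {1..n}" "j \<in> VH" "j' \<in> VH" "{j, j'} \<in> EH"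
      by auto
    then show ?thesis
      unfolding cylinder_edges_def cartesian_product_edges_def by blast
  qed
qed

lemma rung_in_cylinder_edges: "1 \<le> i \<Longrightarrow> i < n \<Longrightarrow> j \<in> VH \<Longrightarrow> rung i j \<in> cylinder_edges VH EH n"
  unfolding cylinder_edges_eq by blast

lemma finite_simple_graph_cylinder:
  assumes "finite_simple_graph VH EH"
  shows "finite_simple_graph (cylinder_verts VH n) (cylinder_edges VH EH n)"
  unfolding finite_simple_graph_def
proof (intro conjI ballI)
  show "finite (cylinder_verts VH n)"
    using assms by (simp add: cylinder_verts_def finite_simple_graph_def)
  fix e assume "e \<in> cylinder_edges VH EH n"
  then consider i j where "e = rung i j" "1 \<le> i" "i < n" "j \<in> VH"
    | i j j' where "e = {(i, j), (i, j')}" "1 \<le> i" "i \<le> n" "j \<in> VH" "j' \<in> VH" "{j, j'} \<in> EH"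
    unfolding cylinder_edges_eq by blast
  then have "e \<subseteq> cylinder_verts VH n \<and> card e = 2"
  proof cases
    case 1
    then show ?thesis by (auto simp: rung_def cylinder_verts_def)
  next
    case 2
    then have "card {j, j'} = 2"
      using assms by (auto simp: finite_simple_graph_def)
    then have "j \<noteq> j'" by auto
    with 2 show ?thesis by (auto simp: cylinder_verts_def)
  qed
  then show "e \<subseteq> cylinder_verts VH n" "card e = 2" by auto
qed

lemma cylinder_verts_add:
  "cylinder_verts VH (m + n) = cylinder_verts VH m \<union> translate m ` cylinder_verts VH n"
proof -
  have "{1..m + n} = {1..m} \<union> (\<lambda>i. i + m) ` {1..n}"
    by (auto simp: image_iff)
  moreover have "translate m ` cylinder_verts VH n = (\<lambda>i. i + m) ` {1..n} \<times> VH"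
  proof (intro equalityI subsetI)
    fix p assume "p \<in> (\<lambda>i. i + m) ` {1..n} \<times> VH"
    then obtain i j where "p = translate m (i, j)" "i \<in> {1..n}" "j \<in> VH"
      by (auto simp del: image_add_atLeastAtMost' image_Suc_atLeastAtMost)
    then show "p \<in> translate m ` cylinder_verts VH n"
      unfolding cylinder_verts_def by blast
  qed (auto simp: cylinder_verts_def)
  ultimately show ?thesis
    by (simp only: cylinder_verts_def Sigma_Un_distrib1)
qed

lemma cylinder_verts_translate_disjoint: "cylinder_verts VH m \<inter> translate m ` cylinder_verts VH n = {}"
  by (auto simp: cylinder_verts_def)

text \<open>Both lengths are positive because the rungs leaving layer \<open>m\<close> are edges of
  the long cylinder only if layers \<open>m\<close> and \<open>m + 1\<close> both exist.\<close>

lemma cylinder_edges_add: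
  assumes "1 \<le> m" "1 \<le> n"
  shows "rung m ` VH \<subseteq> cylinder_edges VH EH (m + n)"
    and "cylinder_edges VH EH (m + n) - rung m ` VH
      = cylinder_edges VH EH m \<union> (`) (translate m) ` cylinder_edges VH EH n" (is "?L = ?R")
proof -
  show "rung m ` VH \<subseteq> cylinder_edges VH EH (m + n)"
    using assms by (auto intro!: rung_in_cylinder_edges)
  show "?L = ?R"
  proof (intro equalityI subsetI)
    fix e assume e: "e \<in> ?L"
    then consider i j where "e = rung i j" "1 \<le> i" "i < m + n" "j \<in> VH"
      | i j j' where "e = {(i, j), (i, j')}" "1 \<le> i" "i \<le> m + n" "j \<in> VH" "j' \<in> VH" "{j, j'} \<in> EH"
      unfolding cylinder_edges_eq by blast
    then show "e \<in> ?R"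
    proof cases
      case 1
      then have "i \<noteq> m" using e by auto
      then consider "i < m" | "m < i" by linarith
      then show ?thesis
      proof cases
        case 1
        then show ?thesis
          using \<open>e = rung i j\<close> \<open>1 \<le> i\<close> \<open>j \<in> VH\<close> by (auto intro!: rung_in_cylinder_edges)
      next
        case 2
        then have "e = translate m ` rung (i - m) j" "rung (i - m) j \<in> cylinder_edges VH EH n"
          using 1 by (auto simp: translate_rung intro!: rung_in_cylinder_edges)
        then show ?thesis by blast
      qed
    next
      case 2
      show ?thesis
      proof (cases "i \<le> m")
        case True
        then show ?thesis using 2 unfolding cylinder_edges_eq by blast
      next
        case False
        then have "e = translate m ` {(i - m, j), (i - m, j')}" using 2 by simp
        moreover have "{(i - m, j), (i - m, j')} \<in> cylinder_edges VH EH n"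
        proof -
          have "1 \<le> i - m" "i - m \<le> n" using False 2 by auto
          then show ?thesis using 2 unfolding cylinder_edges_eq by blast
        qed
        ultimately show ?thesis by blast
      qed
    qed
  next
    fix e assume "e \<in> ?R"
    then consider i j where "e = rung i j" "1 \<le> i" "i < m" "j \<in> VH"
      | i j j' where "e = {(i, j), (i, j')}" "1 \<le> i" "i \<le> m" "j \<in> VH" "j' \<in> VH" "{j, j'} \<in> EH"
      | i j where "e = rung (i + m) j" "1 \<le> i" "i < n" "j \<in> VH"
      | i j j' where "e = {(i + m, j), (i + m, j')}" "1 \<le> i" "i \<le> n" "j \<in> VH" "j' \<in> VH" "{j, j'} \<in> EH"
      unfolding cylinder_edges_eq by (auto simp: translate_rung)
    then show "e \<in> ?L"
    proof cases
      case 1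
      then show ?thesis by (auto simp: rung_eq_iff intro!: rung_in_cylinder_edges)
    next
      case 2
      then have "e \<in> cylinder_edges VH EH (m + n)"
        unfolding cylinder_edges_eq by (blast intro: trans_le_add1)
      moreover have "e \<notin> rung m ` VH" using 2 by (auto simp: rung_def doubleton_eq_iff)
      ultimately show ?thesis by blast
    next
      case 3
      then show ?thesis by (auto simp: rung_eq_iff intro!: rung_in_cylinder_edges)
    next
      case 4
      then have "1 \<le> i + m" "i + m \<le> m + n" by auto
      then have "e \<in> cylinder_edges VH EH (m + n)"
        using 4 unfolding cylinder_edges_eq by blast
      moreover have "e \<notin> rung m ` VH" using 4 by (auto simp: rung_def doubleton_eq_iff)
      ultimately show ?thesis by blast
    qed
  qed
qed

text \<open>The other end lies in the same or an adjacent layer. The count is crude; what matters is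
  that it does not depend on \<open>n\<close>.\<close>

lemma card_incident_edges:
  assumes "finite VH"
  shows "card {e \<in> cylinder_edges VH EH n. v \<in> e} \<le> 3 * card VH"
proof -
  obtain i j where v: "v = (i, j)" by force
  let ?S = "{i - 1, i, i + 1} \<times> VH"
  have "{e \<in> cylinder_edges VH EH n. v \<in> e} \<subseteq> (\<lambda>w. {v, w}) ` ?S"
  proof
    fix e assume "e \<in> {e \<in> cylinder_edges VH EH n. v \<in> e}"
    then have "v \<in> e" "e \<in> cylinder_edges VH EH n" by auto
    then have "\<exists>w\<in>?S. e = {v, w}"
      unfolding cylinder_edges_eq rung_def v by (auto simp: insert_commute)
    then show "e \<in> (\<lambda>w. {v, w}) ` ?S" by blast
  qed
  then have "card {e \<in> cylinder_edges VH EH n. v \<in> e} \<le> card ((\<lambda>w. {v, w}) ` ?S)"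
    using assms by (intro card_mono) auto
  also have "\<dots> \<le> card ?S"
    using assms by (intro card_image_le) auto
  also have "\<dots> \<le> 3 * card VH"
    by (simp add: card_cartesian_product card_insert_if)
  finally show ?thesis .
qed

lemma card_touching_edges:
  assumes H: "finite_simple_graph VH EH" and e: "e \<in> cylinder_edges VH EH n"
  shows "card {e' \<in> cylinder_edges VH EH n - {e}. e' \<inter> e \<noteq> {}} \<le> 6 * card VH"
proof -
  note G = finite_simple_graph_cylinder[OF H, of n]
  have fin: "finite (cylinder_edges VH EH n)" "finite e" "card e = 2" "finite VH"
    using finite_simple_graph_finite_edges[OF G] finite_simple_graph_edgeD[OF G e] H
    by (auto simp: finite_simple_graph_def)
  have "card {e' \<in> cylinder_edges VH EH n - {e}. e' \<inter> e \<noteq> {}}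
      \<le> card (\<Union>v\<in>e. {e' \<in> cylinder_edges VH EH n. v \<in> e'})"
    using fin by (intro card_mono) auto
  also have "\<dots> \<le> (\<Sum>v\<in>e. card {e' \<in> cylinder_edges VH EH n. v \<in> e'})"
    using fin(2) by (rule card_UN_le)
  also have "\<dots> \<le> (\<Sum>v\<in>e. 3 * card VH)"
    using fin(4) by (intro sum_mono card_incident_edges)
  also have "\<dots> = 6 * card VH" using fin(3) by simp
  finally show ?thesis .
qed

text \<open>The lower bound is free, since a matching of the cut graph is also a matching of the
  long cylinder. The upper bound is the price of deleting the rungs, after which the graph is a
  disjoint union with a translated second component.\<close>

lemma log_partition_add_bounds:
  fixes VH :: "'v set" and \<nu> :: "nat \<times> 'v \<Rightarrow> real" and \<omega> :: "(nat \<times> 'v) set \<Rightarrow> real"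
  assumes H: "finite_simple_graph VH EH" and mn: "1 \<le> m" "1 \<le> n"
  defines "Z \<equiv> \<lambda>k. partition_function (cylinder_verts VH k) (cylinder_edges VH EH k)"
  defines "R \<equiv> ln (Z (m + n) \<nu> \<omega>) - ln (Z m \<nu> \<omega>) - ln (Z n (\<nu> \<circ> translate m) (\<omega> \<circ> (`) (translate m)))"
  shows "0 \<le> R" "R \<le> (\<Sum>j\<in>VH. edge_cost \<nu> \<omega> (rung m j))"
proof -
  note G = finite_simple_graph_cylinder[OF H]
  let ?V = "cylinder_verts VH (m + n)" and ?E = "cylinder_edges VH EH (m + n)"
  let ?Z1 = "Z m \<nu> \<omega>" and ?Z2 = "Z n (\<nu> \<circ> translate m) (\<omega> \<circ> (`) (translate m))"
  have finE: "finite (cylinder_edges VH EH k)" for k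
    using finite_simple_graph_finite_edges[OF G] .
  have pos: "0 < ?Z1" "0 < ?Z2" "0 < Z (m + n) \<nu> \<omega>"
    unfolding Z_def by (intro partition_function_pos finE)+
  have translateed: "finite_simple_graph (translate m ` cylinder_verts VH n) ((`) (translate m) ` cylinder_edges VH EH n)"
  proof -
    have "card (translate m ` e) = card e" for e :: "(nat \<times> 'v) set"
      by (rule card_image[OF inj_on_subset[OF inj_translate subset_UNIV]])
    then show ?thesis
      using G[of n] by (auto simp: finite_simple_graph_def)
  qed
  have prod: "partition_function ?V (?E - rung m ` VH) \<nu> \<omega> = ?Z1 * ?Z2"
    unfolding cylinder_edges_add(2)[OF mn] cylinder_verts_add Z_def
      partition_function_disjoint_union[OF G translateed cylinder_verts_translate_disjoint]
      partition_function_image[OF G inj_translate] ..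
  have "?Z1 * ?Z2 \<le> Z (m + n) \<nu> \<omega>"
    unfolding prod[symmetric] unfolding Z_def by (intro partition_function_mono finE) auto
  then have "ln (?Z1 * ?Z2) \<le> ln (Z (m + n) \<nu> \<omega>)"
    using pos by (intro ln_mono) auto
  then show "0 \<le> R"
    using pos by (simp add: R_def ln_mult)
  have "Z (m + n) \<nu> \<omega> \<le> exp (\<Sum>e\<in>rung m ` VH. edge_cost \<nu> \<omega> e) * (?Z1 * ?Z2)"
    unfolding prod[symmetric] unfolding Z_def
    by (rule partition_function_delete_edges[OF G cylinder_edges_add(1)[OF mn]])
  also have "(\<Sum>e\<in>rung m ` VH. edge_cost \<nu> \<omega> e) = (\<Sum>j\<in>VH. edge_cost \<nu> \<omega> (rung m j))"
    by (subst sum.reindex) (auto simp: inj_on_def rung_eq_iff)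
  finally have "ln (Z (m + n) \<nu> \<omega>) \<le> ln (exp (\<Sum>j\<in>VH. edge_cost \<nu> \<omega> (rung m j)) * (?Z1 * ?Z2))"
    using pos by (intro ln_mono) (auto simp: comp_def)
  then show "R \<le> (\<Sum>j\<in>VH. edge_cost \<nu> \<omega> (rung m j))"
    using pos by (simp add: R_def ln_mult)
qed

section \<open>Random weights on cylinders\<close>

text \<open>Indices are all conceivable vertices and edges rather than those of one cylinder, so
  translations act on the index set and no length is singled out.\<close>

type_synonym 'v weight_index = "(nat \<times> 'v) + (nat \<times> 'v) set"

locale random_cylinder =
  fixes VH :: "'v set" and EH :: "'v set set" and N W :: "real measure"
  assumes graph: "finite_simple_graph VH EH" and nonempty: "VH \<noteq> {}"
    and N: "real_distribution N" and W: "real_distribution W"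
    and sqN: "sq_integrable N (\<lambda>x. x)" and sqW: "sq_integrable W (\<lambda>x. x)"
begin

abbreviation law :: "'v weight_index \<Rightarrow> real measure" where
  "law \<equiv> case_sum (\<lambda>_. N) (\<lambda>_. W)"

text \<open>One probability space carries the weights of all cylinders at once, so that cylinders of
  different lengths, and translated ones, can be compared pointwise.\<close>

definition P :: "('v weight_index \<Rightarrow> real) measure" where
  "P = PiM UNIV law"

definition logZ :: "nat \<Rightarrow> ('v weight_index \<Rightarrow> real) \<Rightarrow> real" where
  "logZ n \<theta> = ln (partition_function (cylinder_verts VH n) (cylinder_edges VH EH n) (\<theta> \<circ> Inl) (\<theta> \<circ> Inr))"

definition translate_index :: "nat \<Rightarrow> 'v weight_index \<Rightarrow> 'v weight_index" where
  "translate_index a = map_sum (translate a) ((`) (translate a))"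

lemma graph_finite: "finite VH" "finite (cylinder_edges VH EH n)"
  using graph finite_simple_graph_cylinder[OF graph, of n] finite_simple_graph_finite_edges
  by (auto simp: finite_simple_graph_def)

lemma law_prob: "prob_space (law k)"
  using N W by (auto simp: real_distribution_def split: sum.split)

lemma law_sets: "sets (law k) = sets borel" "space (law k) = UNIV"
  using N W
  by (auto simp: real_distribution_def real_distribution_axioms_def split: sum.split
      dest: sets_eq_imp_space_eq)

lemma sets_P [measurable_cong]: "sets P = sets (PiM UNIV (\<lambda>_. borel))"
  unfolding P_def using law_sets by (intro sets_PiM_cong) auto

sublocale P: prob_space P
  unfolding P_def using law_prob by (rule prob_space_PiM)

lemma coordinate_measurable [measurable]: "(\<lambda>\<theta>. \<theta> k) \<in> borel_measurable P"
  using measurable_component_singleton[of k UNIV "\<lambda>_. borel"]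
  by (simp cong: measurable_cong_sets[OF sets_P refl])

lemma distr_coordinate: "distr P borel (\<lambda>\<theta>. \<theta> k) = law k"
proof -
  have "distr P borel (\<lambda>\<theta>. \<theta> k) = distr P (law k) (\<lambda>\<theta>. \<theta> k)"
    using law_sets by (intro distr_cong) auto
  also have "\<dots> = law k"
    unfolding P_def using law_prob by (intro distr_PiM_component) auto
  finally show ?thesis .
qed

lemma expectation_coordinate:
  fixes g :: "real \<Rightarrow> real"
  assumes "g \<in> borel_measurable borel"
  shows "P.expectation (\<lambda>\<theta>. g (\<theta> k)) = (\<integral>x. g x \<partial>law k)"
  using assms by (simp flip: distr_coordinate add: integral_distr)

lemma sq_integrable_coordinate: "sq_integrable P (\<lambda>\<theta>. \<theta> k)"
proof -
  have "integrable (law k) (\<lambda>x. x\<^sup>2)"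
    using sqN sqW by (auto simp: sq_integrable_def split: sum.split)
  then have "integrable P (\<lambda>\<theta>. (\<theta> k)\<^sup>2)"
    unfolding distr_coordinate[symmetric] by (simp add: integrable_distr_eq)
  then show ?thesis
    by (simp add: sq_integrable_def)
qed

lemma integrable_coordinate: "integrable P (\<lambda>\<theta>. \<theta> k)"
  by (rule P.sq_integrable_imp_integrable[OF sq_integrable_coordinate])

section \<open>Independence and translation invariance\<close>

lemma indep_coordinates: "P.indep_vars (\<lambda>_. borel) (\<lambda>k \<theta>. \<theta> k) UNIV"
proof -
  have "distr P (PiM UNIV (\<lambda>_. borel)) (\<lambda>\<theta>. \<lambda>k\<in>UNIV. \<theta> k) = P"
    using sets_P by (simp add: restrict_UNIV distr_id2)
  also have "P = PiM UNIV (\<lambda>k. distr P borel (\<lambda>\<theta>. \<theta> k))"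
    unfolding distr_coordinate by (simp add: P_def)
  finally show ?thesis
    by (subst P.indep_vars_iff_distr_eq_PiM') auto
qed

text \<open>A section of the restriction to \<open>I\<close>: it exhibits a functional that depends
  only on the coordinates in \<open>I\<close> as a measurable function of the restricted family. The
  value 0 outside \<open>I\<close> is arbitrary.\<close>

definition zero_extend ::
  "'v weight_index set \<Rightarrow> ('v weight_index \<Rightarrow> real) \<Rightarrow> 'v weight_index \<Rightarrow> real" where
  "zero_extend I \<theta> k = (if k \<in> I then \<theta> k else 0)"

lemma zero_extend_measurable: "zero_extend I \<in> measurable (PiM I (\<lambda>_. borel)) P"
proof -
  have "(\<lambda>x k. zero_extend I x k) \<in> measurable (PiM I (\<lambda>_. borel)) (PiM UNIV (\<lambda>_. borel))"
  proof (intro measurable_abs_UNIV)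
    show "(\<lambda>x. zero_extend I x k) \<in> borel_measurable (PiM I (\<lambda>_. borel))" for k
      by (cases "k \<in> I") (simp_all add: zero_extend_def)
  qed
  then show ?thesis
    by (simp cong: measurable_cong_sets[OF refl sets_P])
qed

text \<open>Both functionals factor through restrictions to disjoint sets of independent
  coordinates. Dependence is stated pointwise, so it can be checked without measure theory.\<close>

lemma indep_disjoint_coordinates:
  assumes "F \<in> borel_measurable P" "G \<in> borel_measurable P" "J \<inter> K = {}"
    and F: "\<And>\<theta> \<theta>'. (\<And>k. k \<in> J \<Longrightarrow> \<theta> k = \<theta>' k) \<Longrightarrow> F \<theta> = F \<theta>'"
    and G: "\<And>\<theta> \<theta>'. (\<And>k. k \<in> K \<Longrightarrow> \<theta> k = \<theta>' k) \<Longrightarrow> G \<theta> = G \<theta>'"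
  shows "P.indep_var borel F borel G"
proof -
  have "P.indep_var borel ((F \<circ> zero_extend J) \<circ> (\<lambda>\<theta>. restrict (\<lambda>k. \<theta> k) J))
      borel ((G \<circ> zero_extend K) \<circ> (\<lambda>\<theta>. restrict (\<lambda>k. \<theta> k) K))"
    using assms(1-3)
    by (intro P.indep_var_compose[OF P.indep_var_restrict[OF indep_coordinates]] measurable_comp[OF zero_extend_measurable]) auto
  moreover have "(F \<circ> zero_extend J) \<circ> (\<lambda>\<theta>. restrict (\<lambda>k. \<theta> k) J) = F"
    by (auto simp: fun_eq_iff zero_extend_def intro!: F)
  moreover have "(G \<circ> zero_extend K) \<circ> (\<lambda>\<theta>. restrict (\<lambda>k. \<theta> k) K) = G"
    by (auto simp: fun_eq_iff zero_extend_def intro!: G)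
  ultimately show ?thesis by simp
qed

text \<open>Translation sends vertices to vertices and edges to edges, so it respects the marginal
  laws; an injective reindexing of this kind preserves a product measure.\<close>

lemma distr_translate: "distr P P (\<lambda>\<theta>. \<theta> \<circ> translate_index a) = P"
proof -
  have "inj (translate_index a)"
    unfolding translate_index_def using inj_translate
    by (intro sum.inj_map) (auto simp: inj_image_eq_iff inj_on_def)
  moreover have "law (translate_index a k) = law k" for k
    by (cases k) (auto simp: translate_index_def)
  ultimately show ?thesis
    using distr_PiM_reindex[of UNIV law "translate_index a" UNIV] law_prob
    by (simp add: P_def restrict_UNIV comp_def)
qed

lemma translate_measurable [measurable]: "(\<lambda>\<theta>. \<theta> \<circ> translate_index a) \<in> measurable P P"
proof -
  have "(\<lambda>\<theta> k. \<theta> (translate_index a k)) \<in> measurable P (PiM UNIV (\<lambda>_. borel))"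
    by (intro measurable_abs_UNIV coordinate_measurable)
  then show ?thesis
    by (simp add: comp_def cong: measurable_cong_sets[OF refl sets_P])
qed

lemma logZ_measurable [measurable]: "logZ n \<in> borel_measurable P"
  unfolding logZ_def[abs_def] partition_function_def hamiltonian_def comp_def by measurable

lemma logZ_cong:
  assumes "\<And>k. k \<in> cylinder_verts VH n <+> cylinder_edges VH EH n \<Longrightarrow> \<theta> k = \<theta>' k"
  shows "logZ n \<theta> = logZ n \<theta>'"
  unfolding logZ_def using assms by (intro arg_cong[where f = ln] partition_function_cong) auto

section \<open>Uniform moment bounds\<close>

text \<open>Bounds \<open>edge_cost\<close>; the argument \<open>U\<close> is the set of ends of the edge whose weights enter.\<close>

definition cost_bound :: "(nat \<times> 'v) set \<Rightarrow> (nat \<times> 'v) set \<Rightarrow> ('v weight_index \<Rightarrow> real) \<Rightarrow> real" where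
  "cost_bound U e \<theta> = 1 + \<bar>\<theta> (Inr e)\<bar> + (\<Sum>v\<in>U. \<bar>\<theta> (Inl v)\<bar>)"

definition cost_mean :: real where
  "cost_mean = 1 + (\<integral>x. \<bar>x\<bar> \<partial>W) + 2 * (\<integral>x. \<bar>x\<bar> \<partial>N)"

definition cost_square :: real where
  "cost_square = 4 + 4 * (\<integral>x. x\<^sup>2 \<partial>W) + 8 * (\<integral>x. x\<^sup>2 \<partial>N)"

lemma cost_mean_pos: "0 < cost_mean"
  unfolding cost_mean_def by (intro add_pos_nonneg) auto

lemma cost_square_pos: "0 < cost_square"
  unfolding cost_square_def by (intro add_pos_nonneg) auto

lemma cost_bound_nonneg: "0 \<le> cost_bound U e \<theta>"
  by (simp add: cost_bound_def sum_nonneg)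

lemma edge_cost_le_cost_bound: "edge_cost (\<theta> \<circ> Inl) (\<theta> \<circ> Inr) e \<le> cost_bound e e \<theta>"
  using edge_cost_le[of "\<theta> \<circ> Inl" "\<theta> \<circ> Inr" e] by (simp add: cost_bound_def)

lemma sq_integrable_cost_bound: "sq_integrable P (cost_bound U e)"
  unfolding cost_bound_def[abs_def]
  by (intro sq_integrable_add sq_integrable_sum sq_integrable_abs sq_integrable_coordinate
      P.sq_integrable_const)

lemma integrable_cost_bound: "integrable P (cost_bound U e)"
  by (rule P.sq_integrable_imp_integrable[OF sq_integrable_cost_bound])

lemma expectation_cost_bound:
  assumes "card U \<le> 2"
  shows "P.expectation (cost_bound U e) \<le> cost_mean"
proof -
  have "P.expectation (cost_bound U e) = 1 + (\<integral>x. \<bar>x\<bar> \<partial>W) + card U * (\<integral>x. \<bar>x\<bar> \<partial>N)"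
    unfolding cost_bound_def[abs_def]
    by (simp add: integrable_coordinate P.prob_space expectation_coordinate[where g = abs])
  also have "\<dots> \<le> cost_mean"
    unfolding cost_mean_def using assms by (intro add_left_mono mult_right_mono) auto
  finally show ?thesis .
qed

lemma cost_bound_square:
  assumes "card e = 2"
  shows "P.expectation (\<lambda>\<theta>. (cost_bound e e \<theta>)\<^sup>2) \<le> cost_square"
proof -
  obtain u v where e: "e = {u, v}" "u \<noteq> v"
    using assms by (auto simp: card_2_iff)
  have four: "(1 + a + (b + c))\<^sup>2 \<le> 4 + 4 * a\<^sup>2 + 4 * b\<^sup>2 + 4 * c\<^sup>2" for a b c :: real
  proof -
    \<comment> \<open>The six squared differences of 1, \<open>a\<close>, \<open>b\<close>,
      \<open>c\<close> add up to four times the sum of their squares minus the square of their sum.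
      The last two terms belong to the two ends of the edge, hence the coefficient 8 of the second
      moment of \<open>N\<close> in \<open>cost_square\<close>.\<close>
    have "0 \<le> (1 - a)\<^sup>2 + (1 - b)\<^sup>2 + (1 - c)\<^sup>2 + (a - b)\<^sup>2 + (a - c)\<^sup>2 + (b - c)\<^sup>2"
      by (intro add_nonneg_nonneg) auto
    then show ?thesis by (simp add: power2_eq_square algebra_simps)
  qed
  have "P.expectation (\<lambda>\<theta>. (cost_bound e e \<theta>)\<^sup>2)
      \<le> P.expectation (\<lambda>\<theta>. 4 + 4 * (\<theta> (Inr e))\<^sup>2 + 4 * (\<theta> (Inl u))\<^sup>2 + 4 * (\<theta> (Inl v))\<^sup>2)"
  proof (rule integral_mono)
    show "integrable P (\<lambda>\<theta>. (cost_bound e e \<theta>)\<^sup>2)"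
      using sq_integrable_cost_bound by (simp add: sq_integrable_def)
    show "integrable P (\<lambda>\<theta>. 4 + 4 * (\<theta> (Inr e))\<^sup>2 + 4 * (\<theta> (Inl u))\<^sup>2 + 4 * (\<theta> (Inl v))\<^sup>2)"
      using sq_integrable_coordinate by (simp add: sq_integrable_def)
    show "(cost_bound e e \<theta>)\<^sup>2 \<le> 4 + 4 * (\<theta> (Inr e))\<^sup>2 + 4 * (\<theta> (Inl u))\<^sup>2 + 4 * (\<theta> (Inl v))\<^sup>2" for \<theta>
      using four[of "\<bar>\<theta> (Inr e)\<bar>" "\<bar>\<theta> (Inl u)\<bar>" "\<bar>\<theta> (Inl v)\<bar>"] e by (simp add: cost_bound_def)
  qed
  also have "\<dots> = cost_square"
    using sq_integrable_coordinate
    by (simp add: sq_integrable_def P.prob_space cost_square_def expectation_coordinate[where g = "\<lambda>x. x\<^sup>2"])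
  finally show ?thesis .
qed

text \<open>The empty matching bounds \<open>logZ\<close> from below by the sum of the vertex
  weights, and deleting every edge bounds it from above by that sum plus all costs.\<close>

lemma sq_integrable_logZ: "sq_integrable P (logZ n)"
proof (rule sq_integrable_bound)
  let ?V = "cylinder_verts VH n" and ?E = "cylinder_edges VH EH n"
  note G = finite_simple_graph_cylinder[OF graph, of n]
  show "sq_integrable P (\<lambda>\<theta>. (\<Sum>v\<in>?V. \<bar>\<theta> (Inl v)\<bar>) + (\<Sum>e\<in>?E. cost_bound e e \<theta>))"
    by (intro sq_integrable_add sq_integrable_sum sq_integrable_abs sq_integrable_coordinate
        sq_integrable_cost_bound)
  fix \<theta> :: "'v weight_index \<Rightarrow> real"
  let ?Z = "partition_function ?V ?E (\<theta> \<circ> Inl) (\<theta> \<circ> Inr)"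
  let ?s = "\<Sum>v\<in>?V. \<theta> (Inl v)" and ?c = "\<Sum>e\<in>?E. edge_cost (\<theta> \<circ> Inl) (\<theta> \<circ> Inr) e"
  have pos: "0 < ?Z" by (intro partition_function_pos graph_finite)
  have "exp ?s \<le> ?Z"
    using partition_function_lower[OF graph_finite(2), of "\<theta> \<circ> Inl" ?V n "\<theta> \<circ> Inr"] by simp
  then have lower: "?s \<le> logZ n \<theta>"
    unfolding logZ_def using pos by (simp add: ln_ge_iff)
  have "?Z \<le> exp ?c * exp ?s"
    using partition_function_delete_edges[OF G order_refl, of "\<theta> \<circ> Inl" "\<theta> \<circ> Inr"] by (simp add: partition_function_no_edges)
  then have "ln ?Z \<le> ln (exp (?c + ?s))"
    using pos by (intro ln_mono) (auto simp: exp_add)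
  then have upper: "logZ n \<theta> \<le> ?c + ?s"
    by (simp add: logZ_def)
  have "\<bar>?s\<bar> \<le> (\<Sum>v\<in>?V. \<bar>\<theta> (Inl v)\<bar>)" by (rule sum_abs)
  moreover have "?c \<le> (\<Sum>e\<in>?E. cost_bound e e \<theta>)"
    by (intro sum_mono edge_cost_le_cost_bound)
  moreover have "0 \<le> ?c" by (intro sum_nonneg) simp
  ultimately show "\<bar>logZ n \<theta>\<bar> \<le> (\<Sum>v\<in>?V. \<bar>\<theta> (Inl v)\<bar>) + (\<Sum>e\<in>?E. cost_bound e e \<theta>)"
    using lower upper by linarith
qed simp

lemma integrable_logZ: "integrable P (logZ n)"
  by (rule P.sq_integrable_imp_integrable[OF sq_integrable_logZ])

section \<open>The error of a cut\<close>

definition seam :: "nat \<Rightarrow> nat \<Rightarrow> ('v weight_index \<Rightarrow> real) \<Rightarrow> real" where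
  "seam m n \<theta> = logZ (m + n) \<theta> - (logZ m \<theta> + logZ n (\<theta> \<circ> translate_index m))"

text \<open>A bound for the \<open>L2\<close> norm of a sum of \<open>card VH\<close> costs, each of
  norm at most \<open>sqrt cost_square\<close>; it depends on neither length.\<close>

definition seam_const :: real where
  "seam_const = card VH * sqrt cost_square"

lemma seam_const_pos: "0 < seam_const"
  using nonempty graph_finite cost_square_pos by (simp add: seam_const_def card_gt_0_iff)

lemma logZ_translate_measurable [measurable]:
  "(\<lambda>\<theta>. logZ n (\<theta> \<circ> translate_index m)) \<in> borel_measurable P"
  by measurable

lemma distr_logZ_translate:
  "distr P borel (\<lambda>\<theta>. logZ n (\<theta> \<circ> translate_index m)) = distr P borel (logZ n)"
proof -
  have "distr P borel (logZ n) = distr (distr P P (\<lambda>\<theta>. \<theta> \<circ> translate_index m)) borel (logZ n)"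
    by (simp add: distr_translate)
  also have "\<dots> = distr P borel (logZ n \<circ> (\<lambda>\<theta>. \<theta> \<circ> translate_index m))"
    by (rule distr_distr) measurable
  finally show ?thesis by (simp add: comp_def[of "logZ n"])
qed

lemma expectation_logZ_translate:
  fixes g :: "real \<Rightarrow> real"
  assumes [measurable]: "g \<in> borel_measurable borel"
  shows "P.expectation (\<lambda>\<theta>. g (logZ n (\<theta> \<circ> translate_index m))) = P.expectation (\<lambda>\<theta>. g (logZ n \<theta>))"
proof -
  have "(\<integral>x. g x \<partial>distr P borel (\<lambda>\<theta>. logZ n (\<theta> \<circ> translate_index m)))
      = (\<integral>x. g x \<partial>distr P borel (logZ n))"
    by (simp add: distr_logZ_translate)
  then show ?thesis by (simp add: integral_distr)
qed

lemma sq_integrable_logZ_translate: "sq_integrable P (\<lambda>\<theta>. logZ n (\<theta> \<circ> translate_index m))"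
proof -
  have "integrable (distr P borel (logZ n)) (\<lambda>x. x\<^sup>2)"
    using sq_integrable_logZ[of n] by (simp add: sq_integrable_def integrable_distr_eq)
  then have "integrable (distr P borel (\<lambda>\<theta>. logZ n (\<theta> \<circ> translate_index m))) (\<lambda>x. x\<^sup>2)"
    by (simp add: distr_logZ_translate)
  then show ?thesis
    by (simp add: sq_integrable_def integrable_distr_eq)
qed

lemma seam_bounds:
  assumes mn: "1 \<le> m" "1 \<le> n"
  shows "0 \<le> seam m n \<theta>" "seam m n \<theta> \<le> (\<Sum>j\<in>VH. cost_bound (rung m j) (rung m j) \<theta>)"
proof -
  have 1: "(\<theta> \<circ> translate_index m) \<circ> Inl = (\<theta> \<circ> Inl) \<circ> translate m"
    "(\<theta> \<circ> translate_index m) \<circ> Inr = (\<theta> \<circ> Inr) \<circ> (`) (translate m)"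
    by (simp_all add: fun_eq_iff translate_index_def)
  note bounds = log_partition_add_bounds[OF graph mn, of "\<theta> \<circ> Inl" "\<theta> \<circ> Inr", folded 1, folded logZ_def]
  show "0 \<le> seam m n \<theta>"
    using bounds(1) unfolding seam_def by simp
  have "seam m n \<theta> \<le> (\<Sum>j\<in>VH. edge_cost (\<theta> \<circ> Inl) (\<theta> \<circ> Inr) (rung m j))"
    using bounds(2) unfolding seam_def by simp
  also have "\<dots> \<le> (\<Sum>j\<in>VH. cost_bound (rung m j) (rung m j) \<theta>)"
    by (intro sum_mono edge_cost_le_cost_bound)
  finally show "seam m n \<theta> \<le> (\<Sum>j\<in>VH. cost_bound (rung m j) (rung m j) \<theta>)" .
qed

lemma sq_integrable_seam: "sq_integrable P (seam m n)"
  unfolding seam_def[abs_def]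
  by (intro sq_integrable_diff sq_integrable_add sq_integrable_logZ sq_integrable_logZ_translate)

lemma seam_second_moment:
  assumes mn: "1 \<le> m" "1 \<le> n"
  shows "P.expectation (\<lambda>\<theta>. (seam m n \<theta>)\<^sup>2) \<le> seam_const\<^sup>2"
proof -
  have "P.expectation (\<lambda>\<theta>. (seam m n \<theta>)\<^sup>2)
      \<le> P.expectation (\<lambda>\<theta>. (\<Sum>j\<in>VH. (cost_bound (rung m j) (rung m j) \<theta>)\<^sup>2) * card VH)"
  proof (rule integral_mono)
    show "integrable P (\<lambda>\<theta>. (seam m n \<theta>)\<^sup>2)"
      using sq_integrable_seam by (simp add: sq_integrable_def)
    show "integrable P (\<lambda>\<theta>. (\<Sum>j\<in>VH. (cost_bound (rung m j) (rung m j) \<theta>)\<^sup>2) * card VH)"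
      using sq_integrable_cost_bound by (simp add: sq_integrable_def)
    fix \<theta>
    have "(seam m n \<theta>)\<^sup>2 \<le> (\<Sum>j\<in>VH. cost_bound (rung m j) (rung m j) \<theta>)\<^sup>2"
      using seam_bounds[OF mn] by (intro power_mono) auto
    also have "\<dots> \<le> (\<Sum>j\<in>VH. (cost_bound (rung m j) (rung m j) \<theta>)\<^sup>2) * card VH"
      using sum_squared_le_sum_of_squares by blast
    finally show "(seam m n \<theta>)\<^sup>2 \<le> (\<Sum>j\<in>VH. (cost_bound (rung m j) (rung m j) \<theta>)\<^sup>2) * card VH" .
  qed
  also have "\<dots> = (\<Sum>j\<in>VH. P.expectation (\<lambda>\<theta>. (cost_bound (rung m j) (rung m j) \<theta>)\<^sup>2)) * card VH"
    using sq_integrable_cost_bound by (simp add: sq_integrable_def)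
  also have "\<dots> \<le> (\<Sum>j\<in>VH. cost_square) * card VH"
    by (intro mult_right_mono sum_mono cost_bound_square) (auto simp: rung_def)
  also have "\<dots> = seam_const\<^sup>2"
    using cost_square_pos by (simp add: seam_const_def power_mult_distrib) (simp add: power2_eq_square)
  finally show ?thesis .
qed

lemma logZ_split: "logZ (m + n) \<theta> = (logZ m \<theta> + logZ n (\<theta> \<circ> translate_index m)) + seam m n \<theta>"
  by (simp add: seam_def)

lemma mean_almost_additive:
  assumes mn: "1 \<le> m" "1 \<le> n"
  shows "\<bar>P.expectation (logZ (m + n)) - P.expectation (logZ m) - P.expectation (logZ n)\<bar> \<le> seam_const"
proof -
  have "P.expectation (logZ (m + n)) - P.expectation (logZ m) - P.expectation (logZ n)
      = P.expectation (seam m n)"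
    unfolding seam_def[abs_def]
    using integrable_logZ P.sq_integrable_imp_integrable[OF sq_integrable_logZ_translate]
      expectation_logZ_translate[where g = "\<lambda>x. x"]
    by simp
  moreover have "(P.expectation (seam m n))\<^sup>2 \<le> seam_const\<^sup>2"
    using P.expectation_Cauchy_Schwarz[OF sq_integrable_seam P.sq_integrable_const, of m n 1]
      seam_second_moment[OF mn] by (simp add: P.prob_space)
  ultimately show ?thesis
    using seam_const_pos abs_le_square_iff[of "P.expectation (seam m n)" seam_const] by simp
qed

text \<open>The two pieces read disjoint sets of weights, so their variances add exactly, and the
  seam is an \<open>L2\<close> perturbation of their sum. No edge index is shared because an edge of
  the translated piece is nonempty and lies beyond layer \<open>m\<close>.\<close>

lemma stdev_almost_additive:
  assumes mn: "1 \<le> m" "1 \<le> n"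
  shows "\<bar>P.stdev (logZ (m + n)) - sqrt (P.variance (logZ m) + P.variance (logZ n))\<bar> \<le> seam_const"
proof -
  let ?Y = "\<lambda>\<theta>. logZ n (\<theta> \<circ> translate_index m)"
  have "P.indep_var borel (logZ m) borel ?Y"
  proof (rule indep_disjoint_coordinates)
    let ?I = "\<lambda>k. cylinder_verts VH k <+> cylinder_edges VH EH k"
    show "?I m \<inter> translate_index m ` ?I n = {}"
    proof -
      have verts: "(i + m, j) \<notin> cylinder_verts VH m" if "(i, j) \<in> cylinder_verts VH n" for i j
        using that by (auto simp: cylinder_verts_def)
      have "translate m ` e \<notin> cylinder_edges VH EH m" if e: "e \<in> cylinder_edges VH EH n" for e
      proof
        note G = finite_simple_graph_cylinder[OF graph]
        assume "translate m ` e \<in> cylinder_edges VH EH m"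
        then have "translate m ` e \<subseteq> cylinder_verts VH m"
          by (rule finite_simple_graph_edgeD[OF G])
        moreover have "e \<subseteq> cylinder_verts VH n" "e \<noteq> {}"
          using finite_simple_graph_edgeD[OF G e] by auto
        ultimately show False
          using cylinder_verts_translate_disjoint[of VH m n] by blast
      qed
      with verts show ?thesis
        by (auto simp: translate_index_def Plus_def)
    qed
    show "logZ m \<theta> = logZ m \<theta>'" if "\<And>k. k \<in> ?I m \<Longrightarrow> \<theta> k = \<theta>' k" for \<theta> \<theta>'
      using that by (rule logZ_cong)
    show "?Y \<theta> = ?Y \<theta>'" if "\<And>k. k \<in> translate_index m ` ?I n \<Longrightarrow> \<theta> k = \<theta>' k" for \<theta> \<theta>'
      using that by (intro logZ_cong) auto
  qed measurable
  then have "P.variance (\<lambda>\<theta>. logZ m \<theta> + ?Y \<theta>) = P.variance (logZ m) + P.variance ?Y"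
    by (intro P.variance_add_indep sq_integrable_logZ sq_integrable_logZ_translate)
  also have "P.variance ?Y = P.variance (logZ n)"
    using expectation_logZ_translate[where g = "\<lambda>x. x" and n = n and m = m]
      expectation_logZ_translate[where g = "\<lambda>x. (x - P.expectation (logZ n))\<^sup>2" and n = n and m = m]
    by simp
  finally have "P.stdev (\<lambda>\<theta>. logZ m \<theta> + ?Y \<theta>) = sqrt (P.variance (logZ m) + P.variance (logZ n))"
    by (simp only: P.stdev_def)
  moreover have "logZ (m + n) = (\<lambda>\<theta>. (logZ m \<theta> + ?Y \<theta>) + seam m n \<theta>)"
    using logZ_split by blast
  ultimately show ?thesis
    using P.stdev_perturbation[OF sq_integrable_add[OF sq_integrable_logZ sq_integrable_logZ_translate]
        sq_integrable_seam seam_second_moment[OF mn] less_imp_le[OF seam_const_pos], of m n m]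
    by simp
qed

section \<open>Existence of both limits\<close>

lemma convergent_mean: "convergent (\<lambda>n. P.expectation (logZ n) / n)"
proof (rule almost_additive_convergent)
  fix m n :: nat assume mn: "1 \<le> m" "1 \<le> n"
  \<comment> \<open>The bounded error is deliberately weakened to fit the criterion that also serves
    the variance.\<close>
  have "seam_const * 1 \<le> seam_const * sqrt (real m + real n)"
    using seam_const_pos mn by (intro mult_left_mono) auto
  then show "\<bar>P.expectation (logZ (m + n)) - P.expectation (logZ m) - P.expectation (logZ n)\<bar>
      \<le> seam_const * sqrt (real m + real n)"
    using mean_almost_additive[OF mn] by linarith
qed

lemma convergent_variance: "convergent (\<lambda>n. P.variance (logZ n) / n)"
proof -
  have "P.stdev (logZ (m + n)) \<le> sqrt ((P.stdev (logZ m))\<^sup>2 + (P.stdev (logZ n))\<^sup>2) + seam_const"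
    if "1 \<le> m" "1 \<le> n" for m n
    using stdev_almost_additive[OF that] by (simp add: P.stdev_square)
  from sqrt_growth_bound[OF P.stdev_nonneg seam_const_pos this]
  obtain A where A: "0 \<le> A" "\<And>n. 1 \<le> n \<Longrightarrow> P.stdev (logZ n) \<le> A * sqrt n" by blast
  show ?thesis
  proof (rule almost_additive_convergent)
    fix m n :: nat assume mn: "1 \<le> m" "1 \<le> n"
    define s t where "s = P.stdev (logZ (m + n))"
      and "t = sqrt (P.variance (logZ m) + P.variance (logZ n))"
    have st0: "0 \<le> s" "0 \<le> t"
      by (auto simp: s_def t_def intro!: add_nonneg_nonneg P.variance_positive)
    have s: "s \<le> A * sqrt (real m + real n)"
      using A(2)[of "m + n"] mn by (simp add: s_def)
    have sq: "P.variance (logZ k) \<le> A\<^sup>2 * k" if "1 \<le> k" for k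
      using power_mono[OF A(2)[OF that] P.stdev_nonneg, of 2]
      by (simp add: P.stdev_square power_mult_distrib)
    have "t \<le> sqrt (A\<^sup>2 * (real m + real n))"
      unfolding t_def using sq[OF mn(1)] sq[OF mn(2)] by (intro real_sqrt_le_mono) (simp add: algebra_simps)
    then have t: "t \<le> A * sqrt (real m + real n)"
      using A(1) by (simp add: real_sqrt_mult)
    have "P.variance (logZ (m + n)) - P.variance (logZ m) - P.variance (logZ n) = s\<^sup>2 - t\<^sup>2"
      by (simp add: s_def t_def P.stdev_square add_nonneg_nonneg P.variance_positive)
    \<comment> \<open>Of the two factors, \<open>s - t\<close> is bounded by the seam, and
      \<open>s + t\<close> has order \<open>sqrt (m + n)\<close> by the growth bound.\<close>
    also have "\<bar>s\<^sup>2 - t\<^sup>2\<bar> = \<bar>s - t\<bar> * (s + t)"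
      using st0 by (simp add: power2_eq_square square_diff_square_factored abs_mult)
    also have "\<dots> \<le> seam_const * (A * sqrt (real m + real n) + A * sqrt (real m + real n))"
      using stdev_almost_additive[OF mn] s t st0 seam_const_pos
      by (intro mult_mono add_mono) (auto simp: s_def t_def)
    also have "\<dots> = (2 * seam_const * A) * sqrt (real m + real n)"
      by simp
    finally show "\<bar>P.variance (logZ (m + n)) - P.variance (logZ m) - P.variance (logZ n)\<bar>
        \<le> (2 * seam_const * A) * sqrt (real m + real n)" .
  qed
qed

section \<open>Covariance with one weight and the linear lower bound for the variance\<close>

lemma update_measurable: "(\<lambda>\<theta>. \<theta>(k := x)) \<in> measurable P P"
proof -
  have "(\<lambda>\<theta> i. (\<theta>(k := x)) i) \<in> measurable P (PiM UNIV (\<lambda>_. borel))"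
    by (intro measurable_abs_UNIV) (simp add: fun_upd_def)
  then show ?thesis
    by (simp only: measurable_cong_sets[OF refl sets_P])
qed

text \<open>The abstract covariance estimate is applied with \<open>X0\<close> equal to
  \<open>logZ\<close> after coordinate \<open>k\<close> has been reset to its mean \<open>m\<close>.
  Both this variable and \<open>L\<close> ignore coordinate \<open>k\<close>, which supplies the two
  independence requirements.\<close>

lemma covariance_lower_bound:
  assumes L: "integrable P L" "\<And>\<theta>. 0 \<le> L \<theta>" "P.expectation L \<le> K" "0 < K"
    and indep: "\<And>\<theta> x. L (\<theta>(k := x)) = L \<theta>"
    and affine: "\<And>\<theta>. \<exists>a b. 0 < a \<and> 0 \<le> b \<and> b \<le> exp (L \<theta>) * a
      \<and> (\<forall>x. logZ n (\<theta>(k := x)) = ln (a * exp x + b))"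
  defines "m \<equiv> \<integral>x. x \<partial>law k"
  shows "(\<integral>x. log_gap (exp (2 * K)) m x \<partial>law k) / 2 \<le> P.expectation (\<lambda>\<theta>. logZ n \<theta> * (\<theta> k - m))"
proof -
  have "P.expectation (\<lambda>\<theta>. log_gap (exp (2 * K)) m (\<theta> k)) / 2
      \<le> P.expectation (\<lambda>\<theta>. logZ n \<theta> * (\<theta> k - m))"
  proof (rule P.covariance_log_affine[OF sq_integrable_logZ sq_integrable_coordinate _ _ _ L(1,2,3,4)])
    show "P.expectation (\<lambda>\<theta>. \<theta> k) = m"
      using expectation_coordinate[of "\<lambda>x. x" k] by (simp add: m_def)
    have upd: "\<theta>(k := x) = \<theta>'(k := x)" if "\<And>i. i \<in> - {k} \<Longrightarrow> \<theta> i = \<theta>' i"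
      for \<theta> \<theta>' :: "'v weight_index \<Rightarrow> real" and x
      using that by (auto simp: fun_eq_iff)
    show "P.indep_var borel (\<lambda>\<theta>. logZ n (\<theta>(k := m))) borel (\<lambda>\<theta>. \<theta> k)"
    proof (rule indep_disjoint_coordinates[where J = "- {k}" and K = "{k}"])
      show "(\<lambda>\<theta>. logZ n (\<theta>(k := m))) \<in> borel_measurable P"
        using measurable_compose[OF update_measurable logZ_measurable] .
      show "logZ n (\<theta>(k := m)) = logZ n (\<theta>'(k := m))" if "\<And>i. i \<in> - {k} \<Longrightarrow> \<theta> i = \<theta>' i" for \<theta> \<theta>'
        using upd[OF that] by simp
    qed auto
    show "P.indep_var borel L borel (\<lambda>\<theta>. \<theta> k)"
    proof (rule indep_disjoint_coordinates[where J = "- {k}" and K = "{k}"])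
      show "L \<theta> = L \<theta>'" if "\<And>i. i \<in> - {k} \<Longrightarrow> \<theta> i = \<theta>' i" for \<theta> \<theta>'
      proof -
        \<comment> \<open>Resetting coordinate \<open>k\<close> does not change \<open>L\<close>,
          and it makes the two configurations equal.\<close>
        have "\<theta>(k := 0) = \<theta>'(k := 0)" by (rule upd) (rule that)
        then show ?thesis using indep by metis
      qed
    qed (use L(1) in auto)
    show "\<exists>a b. 0 < a \<and> 0 \<le> b \<and> b \<le> exp (L \<theta>) * a \<and> logZ n \<theta> = ln (a * exp (\<theta> k) + b)
        \<and> logZ n (\<theta>(k := m)) = ln (a * exp m + b)" for \<theta>
      using affine[of \<theta>] by (metis fun_upd_triv)
  qed
  then show ?thesis
    by (simp add: expectation_coordinate[OF borel_measurable_log_gap])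
qed

text \<open>One constant for both kinds of weight: up to \<open>6 * card VH\<close> edges touch a
  given edge, and the extra 1 pays for the vertex weights at its two ends. A vertex meets at most
  half as many edges.\<close>

definition sensitivity_const :: real where
  "sensitivity_const = (6 * card VH + 1) * cost_mean"

lemma sensitivity_const_pos: "0 < sensitivity_const"
  unfolding sensitivity_const_def using cost_mean_pos by (intro mult_pos_pos) auto

lemma covariance_vertex:
  assumes v: "v \<in> cylinder_verts VH n"
  defines "m \<equiv> \<integral>x. x \<partial>N"
  shows "(\<integral>x. log_gap (exp (2 * sensitivity_const)) m x \<partial>N) / 2
    \<le> P.expectation (\<lambda>\<theta>. logZ n \<theta> * (\<theta> (Inl v) - m))"
proof -
  let ?V = "cylinder_verts VH n" and ?E = "cylinder_edges VH EH n"
  let ?S = "{e \<in> ?E. v \<in> e}"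
  note G = finite_simple_graph_cylinder[OF graph, of n]
  \<comment> \<open>The end \<open>v\<close> is removed from each cost so that \<open>L\<close> does
    not depend on the weight under consideration.\<close>
  define L where "L \<theta> = (\<Sum>e\<in>?S. cost_bound (e - {v}) e \<theta>)" for \<theta>
  have cost: "edge_cost ((\<theta> \<circ> Inl)(v := 0)) (\<theta> \<circ> Inr) e \<le> cost_bound (e - {v}) e \<theta>"
    if "e \<in> ?S" for e \<theta>
  proof -
    have "(\<Sum>u\<in>e. \<bar>((\<theta> \<circ> Inl)(v := 0)) u\<bar>) = (\<Sum>u\<in>e - {v}. \<bar>\<theta> (Inl u)\<bar>)"
      using finite_simple_graph_edgeD(1)[OF G] that by (intro sum.mono_neutral_cong_right) auto
    then show ?thesis
      using edge_cost_le[of "(\<theta> \<circ> Inl)(v := 0)" "\<theta> \<circ> Inr" e] by (simp add: cost_bound_def)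
  qed
  have "(\<integral>x. log_gap (exp (2 * sensitivity_const)) (\<integral>x. x \<partial>law (Inl v)) x \<partial>law (Inl v)) / 2
    \<le> P.expectation (\<lambda>\<theta>. logZ n \<theta> * (\<theta> (Inl v) - (\<integral>x. x \<partial>law (Inl v))))"
  proof (rule covariance_lower_bound[where L = L])
    show "integrable P L"
      unfolding L_def[abs_def] by (intro Bochner_Integration.integrable_sum integrable_cost_bound)
    show "0 \<le> L \<theta>" for \<theta>
      unfolding L_def by (intro sum_nonneg cost_bound_nonneg)
    have "P.expectation L = (\<Sum>e\<in>?S. P.expectation (cost_bound (e - {v}) e))"
      unfolding L_def[abs_def] by (intro Bochner_Integration.integral_sum integrable_cost_bound)
    also have "\<dots> \<le> (\<Sum>e\<in>?S. cost_mean)"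
    proof (intro sum_mono expectation_cost_bound)
      fix e assume "e \<in> ?S"
      then show "card (e - {v}) \<le> 2"
        using finite_simple_graph_edgeD(1,2)[OF G, of e] card_mono[of e "e - {v}"] by auto
    qed
    also have "\<dots> = card ?S * cost_mean" by simp
    also have "\<dots> \<le> sensitivity_const"
      unfolding sensitivity_const_def
      using card_incident_edges[OF graph_finite(1), of EH n v] cost_mean_pos
      by (intro mult_right_mono) auto
    finally show "P.expectation L \<le> sensitivity_const" .
    show "L (\<theta>(Inl v := x)) = L \<theta>" for \<theta> x
      unfolding L_def cost_bound_def by (intro sum.cong arg_cong2[where f = "(+)"]) auto
    fix \<theta> :: "'v weight_index \<Rightarrow> real"
    obtain a b where ab: "0 < a" "0 \<le> b"
      "\<And>x. partition_function ?V ?E ((\<theta> \<circ> Inl)(v := x)) (\<theta> \<circ> Inr) = a * exp x + b"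
      "b \<le> exp (\<Sum>e\<in>?S. edge_cost ((\<theta> \<circ> Inl)(v := 0)) (\<theta> \<circ> Inr) e) * a"
      using partition_function_affine_vertex[OF G v, of "\<theta> \<circ> Inl" "\<theta> \<circ> Inr"] by blast
    note ab(4)
    also have "exp (\<Sum>e\<in>?S. edge_cost ((\<theta> \<circ> Inl)(v := 0)) (\<theta> \<circ> Inr) e) * a \<le> exp (L \<theta>) * a"
      unfolding L_def using cost ab(1) by (intro mult_right_mono exp_mono sum_mono) auto
    finally have b: "b \<le> exp (L \<theta>) * a" .
    have "logZ n (\<theta>(Inl v := x)) = ln (a * exp x + b)" for x
    proof -
      have "\<theta>(Inl v := x) \<circ> Inl = (\<theta> \<circ> Inl)(v := x)" "\<theta>(Inl v := x) \<circ> Inr = \<theta> \<circ> Inr"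
        by (auto simp: fun_eq_iff)
      then show ?thesis
        using ab(3)[of x] by (simp only: logZ_def)
    qed
    with ab(1,2) b show "\<exists>a b. 0 < a \<and> 0 \<le> b \<and> b \<le> exp (L \<theta>) * a
      \<and> (\<forall>x. logZ n (\<theta>(Inl v := x)) = ln (a * exp x + b))" by blast
  qed (rule sensitivity_const_pos)
  then show ?thesis by (simp add: m_def)
qed

lemma covariance_edge:
  assumes e: "e \<in> cylinder_edges VH EH n"
  defines "m \<equiv> \<integral>x. x \<partial>W"
  shows "(\<integral>x. log_gap (exp (2 * sensitivity_const)) m x \<partial>W) / 2
    \<le> P.expectation (\<lambda>\<theta>. logZ n \<theta> * (\<theta> (Inr e) - m))"
proof -
  let ?V = "cylinder_verts VH n" and ?E = "cylinder_edges VH EH n"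
  let ?S = "{e' \<in> ?E - {e}. e' \<inter> e \<noteq> {}}"
  note G = finite_simple_graph_cylinder[OF graph, of n]
  \<comment> \<open>The first sum dominates the exponent contributed by the two ends once they are
    isolated; absolute values keep \<open>L\<close> nonnegative, as Markov's inequality
    requires.\<close>
  define L where "L \<theta> = (\<Sum>v\<in>e. \<bar>\<theta> (Inl v)\<bar>) + (\<Sum>e'\<in>?S. cost_bound e' e' \<theta>)"
    for \<theta> :: "'v weight_index \<Rightarrow> real"
  have int: "integrable P (\<lambda>\<theta>. \<Sum>v\<in>e. \<bar>\<theta> (Inl v)\<bar>)" "integrable P (\<lambda>\<theta>. \<Sum>e'\<in>?S. cost_bound e' e' \<theta>)"
    by (intro Bochner_Integration.integrable_sum integrable_cost_bound integrable_abs integrable_coordinate)+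
  have "(\<integral>x. log_gap (exp (2 * sensitivity_const)) (\<integral>x. x \<partial>law (Inr e)) x \<partial>law (Inr e)) / 2
    \<le> P.expectation (\<lambda>\<theta>. logZ n \<theta> * (\<theta> (Inr e) - (\<integral>x. x \<partial>law (Inr e))))"
  proof (rule covariance_lower_bound[where L = L])
    show "integrable P L"
      unfolding L_def[abs_def] by (intro Bochner_Integration.integrable_add int)
    show "0 \<le> L \<theta>" for \<theta>
      unfolding L_def by (intro add_nonneg_nonneg sum_nonneg cost_bound_nonneg) auto
    have "P.expectation L = P.expectation (\<lambda>\<theta>. \<Sum>v\<in>e. \<bar>\<theta> (Inl v)\<bar>)
        + P.expectation (\<lambda>\<theta>. \<Sum>e'\<in>?S. cost_bound e' e' \<theta>)"
      unfolding L_def[abs_def] by (intro Bochner_Integration.integral_add int)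
    also have "P.expectation (\<lambda>\<theta>. \<Sum>v\<in>e. \<bar>\<theta> (Inl v)\<bar>) = 2 * (\<integral>x. \<bar>x\<bar> \<partial>N)"
      using finite_simple_graph_edgeD(2)[OF G e]
      by (simp add: integrable_coordinate expectation_coordinate[where g = abs])
    also have "P.expectation (\<lambda>\<theta>. \<Sum>e'\<in>?S. cost_bound e' e' \<theta>)
        = (\<Sum>e'\<in>?S. P.expectation (cost_bound e' e'))"
      by (intro Bochner_Integration.integral_sum integrable_cost_bound)
    also have "\<dots> \<le> (\<Sum>e'\<in>?S. cost_mean)"
    proof (intro sum_mono expectation_cost_bound)
      fix e' assume "e' \<in> ?S"
      then show "card e' \<le> 2"
        using finite_simple_graph_edgeD(2)[OF G, of e'] by auto
    qed
    also have "\<dots> = card ?S * cost_mean" by simp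
    also have "\<dots> \<le> (6 * card VH) * cost_mean"
      using card_touching_edges[OF graph e] cost_mean_pos by (intro mult_right_mono) auto
    also have "2 * (\<integral>x. \<bar>x\<bar> \<partial>N) \<le> cost_mean"
      by (simp add: cost_mean_def)
    finally show "P.expectation L \<le> sensitivity_const"
      by (simp add: sensitivity_const_def algebra_simps)
    show "L (\<theta>(Inr e := x)) = L \<theta>" for \<theta> x
      unfolding L_def cost_bound_def by (intro sum.cong arg_cong2[where f = "(+)"]) auto
    fix \<theta> :: "'v weight_index \<Rightarrow> real"
    obtain a b where ab: "0 < a" "0 \<le> b"
      "\<And>x. partition_function ?V ?E (\<theta> \<circ> Inl) (fun_upd (\<theta> \<circ> Inr) e x) = a * exp x + b"
      "b \<le> exp ((\<Sum>v\<in>e. (\<theta> \<circ> Inl) v) + (\<Sum>e'\<in>?S. edge_cost (\<theta> \<circ> Inl) (\<theta> \<circ> Inr) e')) * a"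
      using partition_function_affine_edge[OF G e, of "\<theta> \<circ> Inl" "\<theta> \<circ> Inr"] by blast
    note ab(4)
    also have "exp ((\<Sum>v\<in>e. (\<theta> \<circ> Inl) v) + (\<Sum>e'\<in>?S. edge_cost (\<theta> \<circ> Inl) (\<theta> \<circ> Inr) e')) * a
        \<le> exp (L \<theta>) * a"
      unfolding L_def using edge_cost_le_cost_bound ab(1)
      by (intro mult_right_mono exp_mono add_mono sum_mono) auto
    finally have b: "b \<le> exp (L \<theta>) * a" .
    have "logZ n (\<theta>(Inr e := x)) = ln (a * exp x + b)" for x
    proof -
      have "\<theta>(Inr e := x) \<circ> Inl = \<theta> \<circ> Inl" "\<theta>(Inr e := x) \<circ> Inr = fun_upd (\<theta> \<circ> Inr) e x"
        by (auto simp: fun_eq_iff)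
      then show ?thesis
        using ab(3)[of x] by (simp only: logZ_def)
    qed
    with ab(1,2) b show "\<exists>a b. 0 < a \<and> 0 \<le> b \<and> b \<le> exp (L \<theta>) * a
      \<and> (\<forall>x. logZ n (\<theta>(Inr e := x)) = ln (a * exp x + b))" by blast
  qed (rule sensitivity_const_pos)
  then show ?thesis by (simp add: m_def)
qed

text \<open>The range \<open>i < n\<close> has only \<open>n - 1\<close> members because the rung
  from layer \<open>i\<close> exists only then; the same range is used for vertices to treat both
  cases together.\<close>

lemma variance_linear_of_covariance:
  fixes k :: "nat \<Rightarrow> 'v weight_index" and c :: real
  assumes inj: "inj k" and D: "\<And>i. law (k i) = D" and c: "0 < c"
    and cov: "\<And>n i. 1 \<le> i \<Longrightarrow> i < n \<Longrightarrow> c \<le> P.expectation (\<lambda>\<theta>. logZ n \<theta> * (\<theta> (k i) - (\<integral>x. x \<partial>D)))"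
  shows "\<exists>d>0. \<forall>n\<ge>2. d * n \<le> P.variance (logZ n)"
proof -
  let ?m = "\<integral>x. x \<partial>D" and ?t = "\<integral>x. (x - (\<integral>x. x \<partial>D))\<^sup>2 \<partial>D"
  have mean: "P.expectation (\<lambda>\<theta>. \<theta> (k i)) = ?m" for i
    using expectation_coordinate[of "\<lambda>x. x" "k i"] by (simp add: D)
  have var: "P.variance (\<lambda>\<theta>. \<theta> (k i)) = ?t" for i
    using expectation_coordinate[of "\<lambda>x. (x - ?m)\<^sup>2" "k i"] by (simp add: mean D)
  have indep: "P.indep_var borel (\<lambda>\<theta>. \<theta> (k i)) borel (\<lambda>\<theta>. \<theta> (k j))" if "i \<noteq> j" for i j
    using that inj by (intro indep_disjoint_coordinates[where J = "{k i}" and K = "{k j}"])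
      (auto simp: inj_def)
  have main: "(real n - 1) * c\<^sup>2 \<le> ?t * P.variance (logZ n)" if n: "2 \<le> n" for n
  proof -
    have "card {1..<n} * c\<^sup>2 \<le> ?t * P.variance (logZ n)"
    proof (rule P.variance_lower_bound[where Y = "\<lambda>i \<theta>. \<theta> (k i)" and m = ?m])
      show "{1..<n} \<noteq> {}" using n by simp
    qed (use c cov mean var indep sq_integrable_logZ sq_integrable_coordinate in auto)
    then show ?thesis using n by (simp add: of_nat_diff)
  qed
  \<comment> \<open>Positivity of the variance of the weight is read off from the main inequality at
    \<open>n = 2\<close>, whose left side is positive.\<close>
  have "0 < (real 2 - 1) * c\<^sup>2" using c by simp
  also have "\<dots> \<le> ?t * P.variance (logZ 2)" by (rule main) simp
  finally have t: "0 < ?t"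
    using P.variance_positive[of "logZ 2"] by (simp add: zero_less_mult_iff)
  show ?thesis
  proof (intro exI[of _ "c\<^sup>2 / (2 * ?t)"] conjI allI impI)
    show "0 < c\<^sup>2 / (2 * ?t)" using c t by simp
    fix n :: nat assume n: "2 \<le> n"
    \<comment> \<open>For \<open>n >= 2\<close> the count \<open>n - 1\<close> is at least
      \<open>n / 2\<close>; this is the 2 in the witness.\<close>
    have "c\<^sup>2 * n \<le> 2 * ((real n - 1) * c\<^sup>2)"
      using n mult_left_mono[of 2 "real n" "c\<^sup>2"] by (simp add: algebra_simps)
    also have "\<dots> \<le> 2 * (?t * P.variance (logZ n))"
      using main[OF n] by simp
    finally show "c\<^sup>2 / (2 * ?t) * n \<le> P.variance (logZ n)"
      using t by (simp add: field_simps)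
  qed
qed

text \<open>A single column \<open>j\<close> is followed through the layers. If the vertex law is a
  point mass, the rungs of this column take over: they are present for every \<open>H\<close>, even
  when \<open>EH\<close> is empty.\<close>

lemma variance_linear:
  assumes "\<not> (degenerate_law N \<and> degenerate_law W)"
  shows "\<exists>d>0. \<forall>n\<ge>2. d * n \<le> P.variance (logZ n)"
proof -
  obtain j where j: "j \<in> VH" using nonempty by blast
  show ?thesis
  proof (cases "degenerate_law N")
    case False
    show ?thesis
    proof (rule variance_linear_of_covariance[where k = "\<lambda>i. Inl (i, j)" and D = N
          and c = "(\<integral>x. log_gap (exp (2 * sensitivity_const)) (\<integral>x. x \<partial>N) x \<partial>N) / 2"])
      show "0 < (\<integral>x. log_gap (exp (2 * sensitivity_const)) (\<integral>x. x \<partial>N) x \<partial>N) / 2"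
        using expectation_log_gap_pos[OF N sqN False] by simp
    next
      fix n i :: nat assume "1 \<le> i" "i < n"
      then show "(\<integral>x. log_gap (exp (2 * sensitivity_const)) (\<integral>x. x \<partial>N) x \<partial>N) / 2
          \<le> P.expectation (\<lambda>\<theta>. logZ n \<theta> * (\<theta> (Inl (i, j)) - (\<integral>x. x \<partial>N)))"
        using j by (intro covariance_vertex) (auto simp: cylinder_verts_def)
    qed (auto simp: inj_def)
  next
    case True
    then have False': "\<not> degenerate_law W" using assms by simp
    show ?thesis
    proof (rule variance_linear_of_covariance[where k = "\<lambda>i. Inr (rung i j)" and D = W
          and c = "(\<integral>x. log_gap (exp (2 * sensitivity_const)) (\<integral>x. x \<partial>W) x \<partial>W) / 2"])
      show "0 < (\<integral>x. log_gap (exp (2 * sensitivity_const)) (\<integral>x. x \<partial>W) x \<partial>W) / 2"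
        using expectation_log_gap_pos[OF W sqW False'] by simp
    next
      fix n i :: nat assume "1 \<le> i" "i < n"
      then show "(\<integral>x. log_gap (exp (2 * sensitivity_const)) (\<integral>x. x \<partial>W) x \<partial>W) / 2
          \<le> P.expectation (\<lambda>\<theta>. logZ n \<theta> * (\<theta> (Inr (rung i j)) - (\<integral>x. x \<partial>W)))"
        using j by (intro covariance_edge rung_in_cylinder_edges)
    qed (auto simp: inj_def rung_eq_iff)
  qed
qed

section \<open>Convergence in probability and transfer of laws\<close>

lemma tendsto_in_prob_logZ:
  assumes f: "(\<lambda>n. P.expectation (logZ n) / n) \<longlonglongrightarrow> f" and e: "0 < \<epsilon>"
  shows "(\<lambda>n. P.prob {\<theta> \<in> space P. \<epsilon> < \<bar>logZ n \<theta> / n - f\<bar>}) \<longlonglongrightarrow> 0"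
proof (rule tendsto_sandwich[OF _ _ tendsto_const])
  obtain s where s: "(\<lambda>n. P.variance (logZ n) / n) \<longlonglongrightarrow> s"
    using convergent_variance by (auto simp: convergent_def)
  \<comment> \<open>Half of \<open>\<epsilon>\<close> is reserved for the distance from the mean to
    \<open>f\<close>. Chebyshev's inequality at level \<open>n * \<epsilon> / 2\<close> gives this
    bound, in which the normalised variance converges and the factor \<open>1 / n\<close>
    remains.\<close>
  have "(\<lambda>n. (P.variance (logZ n) / n) * ((4 / \<epsilon>\<^sup>2) * (1 / real n))) \<longlonglongrightarrow> s * ((4 / \<epsilon>\<^sup>2) * 0)"
    by (intro tendsto_mult s tendsto_const lim_1_over_n)
  then show "(\<lambda>n. (P.variance (logZ n) / n) * ((4 / \<epsilon>\<^sup>2) * (1 / real n))) \<longlonglongrightarrow> 0"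
    by simp
  have "\<forall>\<^sub>F n in sequentially. dist (P.expectation (logZ n) / n) f < \<epsilon> / 2"
    using tendstoD[OF f, of "\<epsilon> / 2"] e by simp
  then show "\<forall>\<^sub>F n in sequentially. P.prob {\<theta> \<in> space P. \<epsilon> < \<bar>logZ n \<theta> / n - f\<bar>}
      \<le> (P.variance (logZ n) / n) * ((4 / \<epsilon>\<^sup>2) * (1 / real n))"
    using eventually_gt_at_top[of 0]
  proof eventually_elim
    case (elim n)
    have sub: "{\<theta> \<in> space P. \<epsilon> < \<bar>logZ n \<theta> / n - f\<bar>}
        \<subseteq> {\<theta> \<in> space P. \<bar>logZ n \<theta> - P.expectation (logZ n)\<bar> \<ge> n * \<epsilon> / 2}"
    proof safe
      fix \<theta> assume "\<epsilon> < \<bar>logZ n \<theta> / n - f\<bar>"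
      then have "\<epsilon> / 2 \<le> \<bar>logZ n \<theta> / n - P.expectation (logZ n) / n\<bar>"
        using elim(1) unfolding dist_real_def by linarith
      also have "\<dots> = \<bar>logZ n \<theta> - P.expectation (logZ n)\<bar> / n"
        by (simp flip: diff_divide_distrib)
      finally show "n * \<epsilon> / 2 \<le> \<bar>logZ n \<theta> - P.expectation (logZ n)\<bar>"
        using elim(2) by (simp add: field_simps)
    qed
    have "P.prob {\<theta> \<in> space P. \<epsilon> < \<bar>logZ n \<theta> / n - f\<bar>}
        \<le> P.prob {\<theta> \<in> space P. \<bar>logZ n \<theta> - P.expectation (logZ n)\<bar> \<ge> n * \<epsilon> / 2}"
      by (intro P.finite_measure_mono[OF sub]) measurable
    also have "\<dots> \<le> P.variance (logZ n) / (n * \<epsilon> / 2)\<^sup>2"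
      using sq_integrable_logZ[of n] elim(2) e
      by (intro P.Chebyshev_inequality) (auto simp: sq_integrable_def)
    also have "\<dots> = (P.variance (logZ n) / n) * ((4 / \<epsilon>\<^sup>2) * (1 / real n))"
      using elim(2) e by (simp add: field_simps power2_eq_square)
    finally show ?case .
  qed
qed (simp add: measure_nonneg)

text \<open>Independence and the marginals determine the joint law of the finitely many weights
  involved. It equals the law of the restriction of \<open>P\<close> to the same indices, and both
  log partition functions are the same function of these weights.\<close>

lemma log_partition_law:
  assumes iid: "iid_weights M N W (cylinder_verts VH n) (cylinder_edges VH EH n) \<nu> \<omega>" and n: "1 \<le> n"
  defines "X \<equiv> log_partition (cylinder_verts VH n) (cylinder_edges VH EH n) \<nu> \<omega>"
  shows "X \<in> borel_measurable M" "distr M borel X = distr P borel (logZ n)"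
proof -
  let ?V = "cylinder_verts VH n" and ?E = "cylinder_edges VH EH n"
  define I where "I = ?V <+> ?E"
  define Y where "Y = case_sum \<nu> \<omega>"
  define T where "T x = (\<lambda>k\<in>I. Y k x)" for x
  interpret M: prob_space M
    using iid by (simp add: iid_weights_def)
  have indep: "M.indep_vars (\<lambda>_. borel) Y I"
    using iid by (simp add: iid_weights_def I_def Y_def)
  then have meas: "Y k \<in> borel_measurable M" if "k \<in> I" for k
    using that by (auto simp: M.indep_vars_def)
  have T: "T \<in> measurable M (PiM I (\<lambda>_. borel))"
    unfolding T_def[abs_def] by (intro measurable_restrict meas)
  have X: "X = (logZ n \<circ> zero_extend I) \<circ> T"
  proof
    fix x
    show "X x = ((logZ n \<circ> zero_extend I) \<circ> T) x"
      unfolding X_def log_partition_def logZ_def comp_def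
      by (intro arg_cong[where f = ln] partition_function_cong)
        (auto simp: zero_extend_def T_def Y_def I_def)
  qed
  have ext: "logZ n \<circ> zero_extend I \<in> borel_measurable (PiM I (\<lambda>_. borel))"
    by (rule measurable_comp[OF zero_extend_measurable logZ_measurable])
  show "X \<in> borel_measurable M"
    unfolding X by (rule measurable_comp[OF T ext])
  \<comment> \<open>The criterion that identifies independence with a product law asks for a
    nonempty index set; layer 1 provides an index because \<open>1 <= n\<close>.\<close>
  have "(1, SOME j. j \<in> VH) \<in> ?V"
    using n nonempty by (auto simp: cylinder_verts_def some_in_eq)
  then have "I \<noteq> {}" by (auto simp: I_def)
  have law_I: "distr M borel (Y k) = law k" if "k \<in> I" for k
    using that iid by (auto simp: iid_weights_def I_def Y_def)
  have "distr M (PiM I (\<lambda>_. borel)) T = PiM I (\<lambda>k. distr M borel (Y k))"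
    using M.indep_vars_iff_distr_eq_PiM'[OF \<open>I \<noteq> {}\<close>, where M' = "\<lambda>_. borel" and X = Y] meas indep
    by (simp add: T_def[abs_def])
  also have "\<dots> = PiM I law"
    by (intro PiM_cong) (auto simp: law_I)
  finally have TI: "distr M (PiM I (\<lambda>_. borel)) T = PiM I law" .
  have restrict: "(\<lambda>\<theta>. restrict \<theta> I) \<in> measurable P (PiM I (\<lambda>_. borel))"
    by (intro measurable_restrict coordinate_measurable)
  have "distr P (PiM I (\<lambda>_. borel)) (\<lambda>\<theta>. restrict \<theta> I) = distr P (PiM I law) (\<lambda>\<theta>. restrict \<theta> I)"
    using law_sets by (intro distr_cong sets_PiM_cong) auto
  \<comment> \<open>Restriction is the reindexing of the product along the inclusion of
    \<open>I\<close> in the full index set.\<close>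
  also have "\<dots> = PiM I law"
    using distr_PiM_reindex[of UNIV law "\<lambda>k. k" I] law_prob by (simp add: P_def restrict_def)
  finally have PI: "distr P (PiM I (\<lambda>_. borel)) (\<lambda>\<theta>. restrict \<theta> I) = PiM I law" .
  have "distr M borel X = distr (distr M (PiM I (\<lambda>_. borel)) T) borel (logZ n \<circ> zero_extend I)"
    unfolding X by (rule distr_distr[OF ext T, symmetric])
  also have "\<dots> = distr (distr P (PiM I (\<lambda>_. borel)) (\<lambda>\<theta>. restrict \<theta> I)) borel (logZ n \<circ> zero_extend I)"
    by (simp only: TI PI)
  also have "\<dots> = distr P borel ((logZ n \<circ> zero_extend I) \<circ> (\<lambda>\<theta>. restrict \<theta> I))"
    by (rule distr_distr[OF ext restrict])
  also have "(logZ n \<circ> zero_extend I) \<circ> (\<lambda>\<theta>. restrict \<theta> I) = logZ n"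
    unfolding fun_eq_iff comp_def by (intro allI logZ_cong) (simp add: zero_extend_def I_def)
  finally show "distr M borel X = distr P borel (logZ n)" .
qed

lemma transfer_law:
  assumes X: "X \<in> borel_measurable M" and d: "distr M borel X = distr P borel (logZ n)"
  shows "prob_space.variance M X = P.variance (logZ n)"
    and "B \<in> sets borel \<Longrightarrow> measure M {x \<in> space M. X x \<in> B} = P.prob {\<theta> \<in> space P. logZ n \<theta> \<in> B}"
proof -
  have int: "(\<integral>x. g (X x) \<partial>M) = (\<integral>\<theta>. g (logZ n \<theta>) \<partial>P)"
    if "g \<in> borel_measurable borel" for g :: "real \<Rightarrow> real"
  proof -
    have "(\<integral>x. g (X x) \<partial>M) = (\<integral>y. g y \<partial>distr M borel X)"
      using X that by (simp add: integral_distr)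
    also have "\<dots> = (\<integral>\<theta>. g (logZ n \<theta>) \<partial>P)"
      unfolding d using that by (simp add: integral_distr)
    finally show ?thesis .
  qed
  show "prob_space.variance M X = P.variance (logZ n)"
    using int[of "\<lambda>x. x"] int[of "\<lambda>x. (x - P.expectation (logZ n))\<^sup>2"] by simp
  assume B: "B \<in> sets borel"
  have "measure M (X -` B \<inter> space M) = measure P (logZ n -` B \<inter> space P)"
    using measure_distr[OF X B] measure_distr[OF logZ_measurable B, of n] d by simp
  then show "measure M {x \<in> space M. X x \<in> B} = P.prob {\<theta> \<in> space P. logZ n \<theta> \<in> B}"
    by (simp add: vimage_def Int_def conj_commute)
qed

end

text \<open>Both constants are chosen before the probability spaces, so they depend only on the
  graph and the two laws. If both laws were point masses, the log partition function would be almost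
  surely constant and the limiting variance 0, so positivity requires one nondegenerate law.\<close>

theorem theorem1p1:
  fixes VH :: "'v set" and EH :: "'v set set"
    and N W :: "real measure"
  assumes H: "finite_simple_graph VH EH" "VH \<noteq> {}"
    and laws: "real_distribution N" "real_distribution W"
    and second_moment: "integrable (N \<Otimes>\<^sub>M W) (\<lambda>(x, y). x\<^sup>2 + y\<^sup>2)"
    and nondegenerate: "\<not> (degenerate_law N \<and> degenerate_law W)"
  shows "\<exists>f \<sigma>F :: real. \<sigma>F > 0 \<and>
    (\<forall>(M :: nat \<Rightarrow> 'm measure) \<nu> \<omega>.
      (\<forall>n\<ge>1. iid_weights (M n) N W (cylinder_verts VH n) (cylinder_edges VH EH n) (\<nu> n) (\<omega> n)) \<longrightarrow>
      (let logZ = (\<lambda>n. log_partition (cylinder_verts VH n) (cylinder_edges VH EH n) (\<nu> n) (\<omega> n))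
       in tendsto_in_prob M (\<lambda>n x. logZ n x / real n) f \<and>
          (\<lambda>n. prob_space.variance (M n) (logZ n) / real n) \<longlonglongrightarrow> \<sigma>F\<^sup>2))"
proof -
  interpret N: real_distribution N by fact
  interpret W: real_distribution W by fact
  interpret NW: pair_prob_space N W ..
  \<comment> \<open>The moment assumption concerns the pair. By Fubini almost every section is
    integrable; fixing one coordinate at such a value and subtracting the constant leaves the second
    moment of the other law.\<close>
  have "AE x in N. integrable W (\<lambda>y. x\<^sup>2 + y\<^sup>2)"
    using NW.AE_integrable_fst[of "\<lambda>x y. x\<^sup>2 + y\<^sup>2"] second_moment by simp
  then obtain x where "integrable W (\<lambda>y. x\<^sup>2 + y\<^sup>2)"
    using eventually_happens'[OF N.ae_filter_bot] by blast
  from Bochner_Integration.integrable_diff[OF this W.integrable_const[of "x\<^sup>2"]]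
  have sqW: "sq_integrable W (\<lambda>x. x)" by (simp add: sq_integrable_def)
  have "AE y in W. integrable N (\<lambda>x. x\<^sup>2 + y\<^sup>2)"
    using NW.AE_integrable_snd[of "\<lambda>x y. x\<^sup>2 + y\<^sup>2"] second_moment by simp
  then obtain y where "integrable N (\<lambda>x. x\<^sup>2 + y\<^sup>2)"
    using eventually_happens'[OF W.ae_filter_bot] by blast
  from Bochner_Integration.integrable_diff[OF this N.integrable_const[of "y\<^sup>2"]]
  have sqN: "sq_integrable N (\<lambda>x. x)" by (simp add: sq_integrable_def)
  interpret random_cylinder VH EH N W
    using H laws sqN sqW by unfold_locales
  obtain f where f: "(\<lambda>n. P.expectation (logZ n) / n) \<longlonglongrightarrow> f"
    using convergent_mean by (auto simp: convergent_def)
  obtain s where s: "(\<lambda>n. P.variance (logZ n) / n) \<longlonglongrightarrow> s"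
    using convergent_variance by (auto simp: convergent_def)
  obtain d where d: "0 < d" "\<And>n. 2 \<le> n \<Longrightarrow> d * n \<le> P.variance (logZ n)"
    using variance_linear[OF nondegenerate] by blast
  have "d \<le> s"
  proof (rule LIMSEQ_le_const[OF s])
    show "\<exists>K. \<forall>n\<ge>K. d \<le> P.variance (logZ n) / n"
      using d(2) by (intro exI[of _ 2]) (auto simp: field_simps)
  qed
  with d(1) have "0 < s" by simp
  show ?thesis
  proof (rule exI[of _ f], rule exI[of _ "sqrt s"], intro conjI allI impI)
    show "0 < sqrt s" using \<open>0 < s\<close> by simp
  next
    fix M :: "nat \<Rightarrow> 'm measure" and \<nu> \<omega>
    assume iid: "\<forall>n\<ge>1. iid_weights (M n) N W (cylinder_verts VH n) (cylinder_edges VH EH n) (\<nu> n) (\<omega> n)"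
    define X where "X n = log_partition (cylinder_verts VH n) (cylinder_edges VH EH n) (\<nu> n) (\<omega> n)" for n
    have law: "X n \<in> borel_measurable (M n)" "distr (M n) borel (X n) = distr P borel (logZ n)"
      if "1 \<le> n" for n
      using log_partition_law[of "M n" n "\<nu> n" "\<omega> n"] iid that by (auto simp: X_def)
    have "tendsto_in_prob M (\<lambda>n x. X n x / n) f"
      unfolding tendsto_in_prob_def
    proof (intro allI impI)
      fix \<epsilon> :: real assume "0 < \<epsilon>"
      from tendsto_in_prob_logZ[OF f this]
      show "(\<lambda>n. measure (M n) {x \<in> space (M n). \<epsilon> < \<bar>X n x / n - f\<bar>}) \<longlonglongrightarrow> 0"
      proof (rule Lim_transform_eventually)
        \<comment> \<open>The laws agree only for \<open>n >= 1\<close>, since nothing is assumed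
          about the weights at \<open>n = 0\<close>.\<close>
        show "\<forall>\<^sub>F n in sequentially. P.prob {\<theta> \<in> space P. \<epsilon> < \<bar>logZ n \<theta> / n - f\<bar>}
            = measure (M n) {x \<in> space (M n). \<epsilon> < \<bar>X n x / n - f\<bar>}"
          using eventually_ge_at_top[of 1]
        proof eventually_elim
          case (elim n)
          have "{y. \<epsilon> < \<bar>y / n - f\<bar>} \<in> sets borel" by measurable
          from transfer_law(2)[OF law[OF elim] this] show ?case by simp
        qed
      qed
    qed
    moreover have "(\<lambda>n. prob_space.variance (M n) (X n) / n) \<longlonglongrightarrow> (sqrt s)\<^sup>2"
    proof (rule Lim_transform_eventually)
      show "(\<lambda>n. P.variance (logZ n) / n) \<longlonglongrightarrow> (sqrt s)\<^sup>2"
        using s \<open>0 < s\<close> by simp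
      show "\<forall>\<^sub>F n in sequentially. P.variance (logZ n) / n = prob_space.variance (M n) (X n) / n"
        using eventually_ge_at_top[of 1]
        by eventually_elim (simp add: transfer_law(1)[OF law])
    qed
    ultimately show "let logZ = (\<lambda>n. log_partition (cylinder_verts VH n) (cylinder_edges VH EH n) (\<nu> n) (\<omega> n))
       in tendsto_in_prob M (\<lambda>n x. logZ n x / real n) f \<and>
          (\<lambda>n. prob_space.variance (M n) (logZ n) / real n) \<longlonglongrightarrow> (sqrt s)\<^sup>2"
      unfolding Let_def X_def[abs_def] by blast
  qed
qed

end
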